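(* Let $R$ be a ring, $\sigma:R\to R$ a ring endomorphism, and $\delta:R\to R$ a $\sigma$-derivation. Then the following four statements hold. (i) If $R$ satisfies LSRC, then $R[x;\sigma,\delta]$ satisfies LSRC. (ii) If $\sigma$ is an automorphism and $R$ satisfies RSRC, then $R[x;\sigma,\delta]$ satisfies RSRC. (iii) If $R[x;\sigma,\delta]$ satisfies RSRC, then $R$ satisfies RSRC. (iv) If $\sigma$ is an automorphism and $R[x;\sigma,\delta]$ satisfies LSRC, then $R$ satisfies LSRC.
   Context: Rings are associative and unital (not necessarily commutative), and ring homomorphisms preserve unit elements. A $\sigma$-derivation is an additive map $\delta:R\to R$ with $\delta(rs)=\delta(r)s+\sigma(r)\delta(s)$ for all $r,s\in R$. The Ore extension $R[x;\sigma,\delta]$ is the ring of all polynomials in the variable $x$ with coefficients in $R$ written on the left (so it is a free left $R$-module on $\{1,x,x^2,\dots\}$), with multiplication governed by $xr=\sigma(r)x+\delta(r)$ for all $r\in R$. A ring $R$ satisfies the right strong rank condition (RSRC) if, for every positive integer $n$, there is no right $R$-module monomorphism $R^{n+1}\to R^n$; it satisfies the left strong rank condition (LSRC) if, for every positive integer $n$, there is no left $R$-module monomorphism $R^{n+1}\to R^n$. *)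

theory Defs
  imports "HOL-Algebra.Algebra"
begin

section \<open>The strong rank conditions\<close>

text \<open>
  \<open>free_mod R n\<close> is \<open>R\<^sup>n\<close> with coordinates indexed by \<open>{..<n}\<close>. Library modules live over
  commutative rings, so left and right linearity are spelled out here.
\<close>

definition free_mod :: "('a, 'm) ring_scheme \<Rightarrow> nat \<Rightarrow> (nat \<Rightarrow> 'a) set" where
  "free_mod R n = {..<n} \<rightarrow>\<^sub>E carrier R"

definition vec_add :: "('a, 'm) ring_scheme \<Rightarrow> nat \<Rightarrow> (nat \<Rightarrow> 'a) \<Rightarrow> (nat \<Rightarrow> 'a) \<Rightarrow> nat \<Rightarrow> 'a" where
  "vec_add R n u v = (\<lambda>i\<in>{..<n}. u i \<oplus>\<^bsub>R\<^esub> v i)"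

definition left_smult :: "('a, 'm) ring_scheme \<Rightarrow> nat \<Rightarrow> 'a \<Rightarrow> (nat \<Rightarrow> 'a) \<Rightarrow> nat \<Rightarrow> 'a" where
  "left_smult R n r v = (\<lambda>i\<in>{..<n}. r \<otimes>\<^bsub>R\<^esub> v i)"

definition right_smult :: "('a, 'm) ring_scheme \<Rightarrow> nat \<Rightarrow> (nat \<Rightarrow> 'a) \<Rightarrow> 'a \<Rightarrow> nat \<Rightarrow> 'a" where
  "right_smult R n v r = (\<lambda>i\<in>{..<n}. v i \<otimes>\<^bsub>R\<^esub> r)"

definition left_hom :: "('a, 'm) ring_scheme \<Rightarrow> nat \<Rightarrow> nat \<Rightarrow> ((nat \<Rightarrow> 'a) \<Rightarrow> nat \<Rightarrow> 'a) set" where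
  "left_hom R m n = {f. f \<in> free_mod R m \<rightarrow> free_mod R n \<and>
     (\<forall>u\<in>free_mod R m. \<forall>v\<in>free_mod R m. f (vec_add R m u v) = vec_add R n (f u) (f v)) \<and>
     (\<forall>r\<in>carrier R. \<forall>v\<in>free_mod R m. f (left_smult R m r v) = left_smult R n r (f v))}"

definition right_hom :: "('a, 'm) ring_scheme \<Rightarrow> nat \<Rightarrow> nat \<Rightarrow> ((nat \<Rightarrow> 'a) \<Rightarrow> nat \<Rightarrow> 'a) set" where
  "right_hom R m n = {f. f \<in> free_mod R m \<rightarrow> free_mod R n \<and>
     (\<forall>u\<in>free_mod R m. \<forall>v\<in>free_mod R m. f (vec_add R m u v) = vec_add R n (f u) (f v)) \<and>
     (\<forall>v\<in>free_mod R m. \<forall>r\<in>carrier R. f (right_smult R m v r) = right_smult R n (f v) r)}"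

definition LSRC :: "('a, 'm) ring_scheme \<Rightarrow> bool" where
  "LSRC R \<longleftrightarrow> (\<forall>n\<ge>1. \<not> (\<exists>f\<in>left_hom R (n + 1) n. inj_on f (free_mod R (n + 1))))"

definition RSRC :: "('a, 'm) ring_scheme \<Rightarrow> bool" where
  "RSRC R \<longleftrightarrow> (\<forall>n\<ge>1. \<not> (\<exists>f\<in>right_hom R (n + 1) n. inj_on f (free_mod R (n + 1))))"


section \<open>Ore extensions\<close>

definition skew_derivation ::
    "('a, 'm) ring_scheme \<Rightarrow> ('a \<Rightarrow> 'a) \<Rightarrow> ('a \<Rightarrow> 'a) \<Rightarrow> bool" where
  "skew_derivation R \<sigma> \<delta> \<longleftrightarrow> \<delta> \<in> carrier R \<rightarrow> carrier R \<and>
     (\<forall>r\<in>carrier R. \<forall>s\<in>carrier R. \<delta> (r \<oplus>\<^bsub>R\<^esub> s) = \<delta> r \<oplus>\<^bsub>R\<^esub> \<delta> s) \<and>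
     (\<forall>r\<in>carrier R. \<forall>s\<in>carrier R.
        \<delta> (r \<otimes>\<^bsub>R\<^esub> s) = (\<delta> r \<otimes>\<^bsub>R\<^esub> s) \<oplus>\<^bsub>R\<^esub> (\<sigma> r \<otimes>\<^bsub>R\<^esub> \<delta> s))"

text \<open>
  A polynomial is its sequence of left coefficients. Left multiplication by \<open>x\<close> is forced by
  \<open>x r = \<sigma>(r) x + \<delta>(r)\<close>: it sends \<open>\<Sum> q\<^sub>n x\<^sup>n\<close> to \<open>\<Sum> (\<sigma>(q\<^sub>n) x\<^sup>n\<^sup>+\<^sup>1 + \<delta>(q\<^sub>n) x\<^sup>n)\<close>. Then
  \<open>(\<Sum> p\<^sub>i x\<^sup>i) q = \<Sum> p\<^sub>i (x\<^sup>i q)\<close>; the sum below runs over the (finite) support of \<open>p\<close>.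
\<close>

definition ore_shift ::
    "('a, 'm) ring_scheme \<Rightarrow> ('a \<Rightarrow> 'a) \<Rightarrow> ('a \<Rightarrow> 'a) \<Rightarrow> (nat \<Rightarrow> 'a) \<Rightarrow> nat \<Rightarrow> 'a" where
  "ore_shift R \<sigma> \<delta> q =
     (\<lambda>n. (if n = 0 then \<zero>\<^bsub>R\<^esub> else \<sigma> (q (n - 1))) \<oplus>\<^bsub>R\<^esub> \<delta> (q n))"

definition ore_extension ::
    "('a, 'm) ring_scheme \<Rightarrow> ('a \<Rightarrow> 'a) \<Rightarrow> ('a \<Rightarrow> 'a) \<Rightarrow> (nat \<Rightarrow> 'a) ring" where
  "ore_extension R \<sigma> \<delta> = \<lparr>
     carrier = up R,
     monoid.mult = (\<lambda>p q n. \<Oplus>\<^bsub>R\<^esub>i\<in>{i. p i \<noteq> \<zero>\<^bsub>R\<^esub>}. p i \<otimes>\<^bsub>R\<^esub> (ore_shift R \<sigma> \<delta> ^^ i) q n),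
     monoid.one = (\<lambda>n. if n = 0 then \<one>\<^bsub>R\<^esub> else \<zero>\<^bsub>R\<^esub>),
     ring.zero = (\<lambda>n. \<zero>\<^bsub>R\<^esub>),
     ring.add = (\<lambda>p q n. p n \<oplus>\<^bsub>R\<^esub> q n)\<rparr>"

definition ore_monom :: "('a, 'm) ring_scheme \<Rightarrow> 'a \<Rightarrow> nat \<Rightarrow> nat \<Rightarrow> 'a" where
  "ore_monom R a k = (\<lambda>n. if n = k then a else \<zero>\<^bsub>R\<^esub>)"


subsection \<open>The construction is the Ore extension\<close>

locale ore = ring R for R (structure) +
  fixes \<sigma> \<delta> :: "'a \<Rightarrow> 'a"
  assumes sigma: "\<sigma> \<in> ring_hom R R" and delta: "skew_derivation R \<sigma> \<delta>"
begin

abbreviation xop where "xop \<equiv> ore_shift R \<sigma> \<delta>"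
abbreviation Ore where "Ore \<equiv> ore_extension R \<sigma> \<delta>"

lemma sigma_simps [simp]:
  "r \<in> carrier R \<Longrightarrow> \<sigma> r \<in> carrier R"
  "r \<in> carrier R \<Longrightarrow> s \<in> carrier R \<Longrightarrow> \<sigma> (r \<oplus> s) = \<sigma> r \<oplus> \<sigma> s"
  "r \<in> carrier R \<Longrightarrow> s \<in> carrier R \<Longrightarrow> \<sigma> (r \<otimes> s) = \<sigma> r \<otimes> \<sigma> s"
  "\<sigma> \<one> = \<one>" "\<sigma> \<zero> = \<zero>"
  using sigma ring_axioms by (auto simp: ring_hom_closed ring_hom_add ring_hom_mult ring_hom_one ring_hom_zero)

lemma delta_simps [simp]:
  "r \<in> carrier R \<Longrightarrow> \<delta> r \<in> carrier R"
  "r \<in> carrier R \<Longrightarrow> s \<in> carrier R \<Longrightarrow> \<delta> (r \<oplus> s) = \<delta> r \<oplus> \<delta> s"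
  "r \<in> carrier R \<Longrightarrow> s \<in> carrier R \<Longrightarrow> \<delta> (r \<otimes> s) = \<delta> r \<otimes> s \<oplus> \<sigma> r \<otimes> \<delta> s"
  using delta by (auto simp: skew_derivation_def)

lemma delta_zero [simp]: "\<delta> \<zero> = \<zero>"
  using delta_simps(2)[of \<zero> \<zero>] by (metis add.l_cancel_one' delta_simps(1) r_zero zero_closed)

lemma delta_one [simp]: "\<delta> \<one> = \<zero>"
  using delta_simps(3)[of \<one> \<one>] by (metis add.l_cancel_one' delta_simps(1) l_one one_closed r_one sigma_simps(4))

lemma up_closed: "p \<in> up R \<Longrightarrow> p n \<in> carrier R"
  by (rule mem_upD)

lemma up_iff: "p \<in> up R \<longleftrightarrow> (\<forall>n. p n \<in> carrier R) \<and> (\<exists>N. \<forall>n>N. p n = \<zero>)"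
  by (auto simp: up_def bound_def Pi_def)

lemma X_up [simp]: assumes "p \<in> up R" shows "xop p \<in> up R"
proof -
  obtain N where N: "\<forall>n>N. p n = \<zero>" using assms up_iff by blast
  have "\<forall>n>Suc N. xop p n = \<zero>" using N by (auto simp: ore_shift_def)
  then show ?thesis using assms by (auto simp: up_iff ore_shift_def)
qed

lemma Xi_up [simp]: "p \<in> up R \<Longrightarrow> (xop ^^ i) p \<in> up R"
  by (induction i) auto

lemma xop_closed [simp]:
  "p \<in> up R \<Longrightarrow> xop p n \<in> carrier R"
  "p \<in> up R \<Longrightarrow> (xop ^^ i) p n \<in> carrier R"
  by (simp_all add: up_closed)

lemma add_up [simp]: "p \<in> up R \<Longrightarrow> q \<in> up R \<Longrightarrow> (\<lambda>n. p n \<oplus> q n) \<in> up R"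
  by (rule up_add_closed)

lemma smult_up [simp]: "a \<in> carrier R \<Longrightarrow> p \<in> up R \<Longrightarrow> (\<lambda>n. a \<otimes> p n) \<in> up R"
  by (rule up_smult_closed)

lemma X_add: "p \<in> up R \<Longrightarrow> q \<in> up R \<Longrightarrow> xop (\<lambda>n. p n \<oplus> q n) = (\<lambda>n. xop p n \<oplus> xop q n)"
  by (rule ext) (auto simp: ore_shift_def a_ac up_closed)

lemma Xi_add: "p \<in> up R \<Longrightarrow> q \<in> up R \<Longrightarrow>
    (xop ^^ i) (\<lambda>n. p n \<oplus> q n) = (\<lambda>n. (xop ^^ i) p n \<oplus> (xop ^^ i) q n)"
  by (induction i) (auto simp: X_add)

lemma X_smult: "a \<in> carrier R \<Longrightarrow> p \<in> up R \<Longrightarrow>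
    xop (\<lambda>n. a \<otimes> p n) = (\<lambda>n. \<sigma> a \<otimes> xop p n \<oplus> \<delta> a \<otimes> p n)"
  by (rule ext) (auto simp: ore_shift_def r_distr a_ac m_assoc up_closed)

lemma mult_S: "monoid.mult Ore p q = (\<lambda>n. \<Oplus>i\<in>{i. p i \<noteq> \<zero>}. p i \<otimes> (xop ^^ i) q n)"
  by (simp add: ore_extension_def)

lemma mult_bound:
  assumes "p \<in> up R" "q \<in> up R" "\<forall>n>N. p n = \<zero>"
  shows "monoid.mult Ore p q = (\<lambda>n. \<Oplus>i\<in>{..N}. p i \<otimes> (xop ^^ i) q n)"
proof
  fix n
  have "{i. p i \<noteq> \<zero>} \<subseteq> {..N}" using assms(3) not_le by auto
  then show "monoid.mult Ore p q n = (\<Oplus>i\<in>{..N}. p i \<otimes> (xop ^^ i) q n)"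
    unfolding mult_S
    by (intro add.finprod_mono_neutral_cong_left) (use assms in auto)
qed

lemma partial_up:
  "p \<in> up R \<Longrightarrow> q \<in> up R \<Longrightarrow> (\<lambda>n. \<Oplus>i\<in>{..N::nat}. p i \<otimes> (xop ^^ i) q n) \<in> up R"
proof (induction N)
  case (Suc N)
  have "(\<lambda>n. \<Oplus>i\<in>{..Suc N}. p i \<otimes> (xop ^^ i) q n)
     = (\<lambda>n. p (Suc N) \<otimes> (xop ^^ Suc N) q n \<oplus> (\<Oplus>i\<in>{..N}. p i \<otimes> (xop ^^ i) q n))"
    using Suc.prems Xi_up[of q] by (intro ext, subst finsum_Suc) (auto simp del: funpow.simps)
  then show ?case using Suc by (simp add: up_closed del: funpow.simps)
qed (simp add: up_closed)

lemma up_bound_ex: "p \<in> up R \<Longrightarrow> \<exists>N. \<forall>n>N. p n = \<zero>"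
  by (simp add: up_iff)

lemma up_bound2: "p \<in> up R \<Longrightarrow> q \<in> up R \<Longrightarrow> \<exists>N. (\<forall>n>N. p n = \<zero>) \<and> (\<forall>n>N. q n = \<zero>)"
proof -
  assume "p \<in> up R" "q \<in> up R"
  then obtain M N where "\<forall>n>M. p n = \<zero>" "\<forall>n>N. q n = \<zero>" using up_bound_ex by metis
  then have "(\<forall>n>max M N. p n = \<zero>) \<and> (\<forall>n>max M N. q n = \<zero>)" by simp
  then show ?thesis by blast
qed

lemma mult_up [simp]: "p \<in> up R \<Longrightarrow> q \<in> up R \<Longrightarrow> monoid.mult Ore p q \<in> up R"
  using up_bound_ex[of p] by (auto simp: mult_bound partial_up)

lemma mult_add_left:
  assumes "p \<in> up R" "p' \<in> up R" "q \<in> up R"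
  shows "monoid.mult Ore (\<lambda>n. p n \<oplus> p' n) q = (\<lambda>n. monoid.mult Ore p q n \<oplus> monoid.mult Ore p' q n)"
proof -
  obtain N where N: "\<forall>n>N. p n = \<zero>" "\<forall>n>N. p' n = \<zero>" using up_bound2 assms by metis
  then have "\<forall>n>N. p n \<oplus> p' n = \<zero>" by simp
  moreover have "\<And>n. p n \<in> carrier R" "\<And>n. p' n \<in> carrier R" using assms up_closed by auto
  ultimately show ?thesis using N assms
    by (simp add: mult_bound[where N = N] l_distr)
qed

lemma mult_add_right:
  assumes "p \<in> up R" "q \<in> up R" "q' \<in> up R"
  shows "monoid.mult Ore p (\<lambda>n. q n \<oplus> q' n) = (\<lambda>n. monoid.mult Ore p q n \<oplus> monoid.mult Ore p q' n)"
proof -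
  obtain N where N: "\<forall>n>N. p n = \<zero>" using up_bound_ex assms by metis
  moreover have "\<And>n. p n \<in> carrier R" using assms up_closed by auto
  ultimately show ?thesis using assms
    by (simp add: mult_bound[where N = N] r_distr Xi_add)
qed

lemma mult_smult_left:
  assumes "a \<in> carrier R" "p \<in> up R" "q \<in> up R"
  shows "monoid.mult Ore (\<lambda>n. a \<otimes> p n) q = (\<lambda>n. a \<otimes> monoid.mult Ore p q n)"
proof -
  obtain N where N: "\<forall>n>N. p n = \<zero>" using up_bound_ex assms by metis
  moreover have p: "\<And>n. p n \<in> carrier R" using assms up_closed by auto
  moreover have "\<forall>n>N. a \<otimes> p n = \<zero>" using N assms by simp
  ultimately show ?thesis using assms
    by (simp add: mult_bound[where N = N] finsum_rdistr m_assoc)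
qed

lemma ore_monom_up [simp]: "a \<in> carrier R \<Longrightarrow> ore_monom R a k \<in> up R"
  by (auto simp: ore_monom_def up_iff)

lemma zero_up: "(\<lambda>n. \<zero>) \<in> up R"
  by (simp add: up_iff)

lemma ore_monom_apply: "ore_monom R a k n = (if n = k then a else \<zero>)"
  by (simp add: ore_monom_def)

lemma mult_monom:
  assumes "a \<in> carrier R" "q \<in> up R"
  shows "monoid.mult Ore (ore_monom R a k) q = (\<lambda>n. a \<otimes> (xop ^^ k) q n)"
proof
  fix n
  have "monoid.mult Ore (ore_monom R a k) q n
      = (\<Oplus>i\<in>{..k}. if k = i then a \<otimes> (xop ^^ i) q n else \<zero>)"
    using assms
    by (subst mult_bound[where N = k]) (auto intro!: finsum_cong' simp: ore_monom_apply)
  also have "\<dots> = a \<otimes> (xop ^^ k) q n"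
    using assms finsum_singleton[of k "{..k}" "\<lambda>i. a \<otimes> (xop ^^ i) q n"] by auto
  finally show "monoid.mult Ore (ore_monom R a k) q n = a \<otimes> (xop ^^ k) q n" .
qed

lemma X_monom: "a \<in> carrier R \<Longrightarrow>
    xop (ore_monom R a k) = (\<lambda>n. ore_monom R (\<sigma> a) (Suc k) n \<oplus> ore_monom R (\<delta> a) k n)"
  by (rule ext) (auto simp: ore_shift_def ore_monom_def)

lemma X_monom_one: "xop (ore_monom R \<one> k) = ore_monom R \<one> (Suc k)"
  by (rule ext) (simp add: X_monom, simp add: ore_monom_def)

lemma mult_monom_X: "a \<in> carrier R \<Longrightarrow> q \<in> up R \<Longrightarrow>
    monoid.mult Ore (xop (ore_monom R a k)) q = xop (monoid.mult Ore (ore_monom R a k) q)"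
  by (simp add: X_monom mult_add_left mult_monom X_smult[of a "(xop ^^ k) q"])

lemma up_induct [consumes 1, case_names monom add]:
  assumes p: "p \<in> up R"
    and m: "\<And>a k. a \<in> carrier R \<Longrightarrow> P (ore_monom R a k)"
    and a: "\<And>p q. p \<in> up R \<Longrightarrow> q \<in> up R \<Longrightarrow> P p \<Longrightarrow> P q \<Longrightarrow> P (\<lambda>n. p n \<oplus> q n)"
  shows "P p"
proof -
  have *: "\<forall>n\<ge>N. p n = \<zero> \<Longrightarrow> p \<in> up R \<Longrightarrow> P p" for N p
  proof (induction N arbitrary: p)
    case 0
    then have "p = ore_monom R \<zero> 0" by (auto simp: ore_monom_def)
    then show ?case using m by simp
  next
    case (Suc N)
    let ?q = "p(N := \<zero>)"
    have q: "?q \<in> up R" using Suc.prems by (auto simp: up_iff)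
    have "\<forall>n\<ge>N. ?q n = \<zero>" using Suc.prems by auto
    then have "P ?q" using Suc.IH q by blast
    moreover have "p = (\<lambda>n. ?q n \<oplus> ore_monom R (p N) N n)"
      using Suc.prems by (intro ext) (auto simp: ore_monom_def up_closed)
    ultimately show ?case
      using a[of ?q "ore_monom R (p N) N"] q Suc.prems m by (simp add: up_closed)
  qed
  obtain N where "\<forall>n>N. p n = \<zero>" using up_bound_ex p by blast
  then have "\<forall>n\<ge>Suc N. p n = \<zero>" by auto
  then show ?thesis using * p by blast
qed

lemma mult_X: "p \<in> up R \<Longrightarrow> q \<in> up R \<Longrightarrow> monoid.mult Ore (xop p) q = xop (monoid.mult Ore p q)"
  by (induction p rule: up_induct) (simp_all add: mult_monom_X X_add mult_add_left)

lemma mult_Xi: "p \<in> up R \<Longrightarrow> q \<in> up R \<Longrightarrow> monoid.mult Ore ((xop ^^ i) p) q = (xop ^^ i) (monoid.mult Ore p q)"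
  by (induction i) (auto simp: mult_X)

lemma mult_assoc_S:
  assumes "p \<in> up R" "q \<in> up R" "r \<in> up R"
  shows "monoid.mult Ore (monoid.mult Ore p q) r = monoid.mult Ore p (monoid.mult Ore q r)"
  using assms
  by (induction p rule: up_induct) (simp_all add: mult_monom mult_smult_left mult_Xi mult_add_left)

lemma one_S: "\<one>\<^bsub>Ore\<^esub> = ore_monom R \<one> 0"
  by (auto simp: ore_extension_def ore_monom_def)

lemma Xi_one: "(xop ^^ i) (ore_monom R \<one> 0) = ore_monom R \<one> i"
  by (induction i) (auto simp: X_monom_one)

lemma smult_monom_one: "a \<in> carrier R \<Longrightarrow> (\<lambda>n. a \<otimes> ore_monom R \<one> k n) = ore_monom R a k"
  by (rule ext) (simp add: ore_monom_def)

lemma ore_ring: "ring Ore"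
proof (rule ringI)
  show "abelian_group Ore"
  proof (rule abelian_groupI)
    fix p assume "p \<in> carrier Ore"
    then have p: "p \<in> up R" by (simp add: ore_extension_def)
    then show "\<exists>y\<in>carrier Ore. y \<oplus>\<^bsub>Ore\<^esub> p = \<zero>\<^bsub>Ore\<^esub>"
      by (intro bexI[of _ "\<lambda>n. \<ominus> p n"]) (auto simp: ore_extension_def l_neg up_a_inv_closed up_closed)
  qed (auto simp: ore_extension_def a_ac up_closed zero_up)
  show "monoid Ore"
  proof (rule monoidI)
    fix p assume "p \<in> carrier Ore"
    then have p: "p \<in> up R" by (simp add: ore_extension_def)
    show "\<one>\<^bsub>Ore\<^esub> \<otimes>\<^bsub>Ore\<^esub> p = p" using p by (simp add: one_S mult_monom up_closed)
    show "p \<otimes>\<^bsub>Ore\<^esub> \<one>\<^bsub>Ore\<^esub> = p" using p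
      by (induction p rule: up_induct) (simp_all add: one_S mult_monom Xi_one mult_add_left smult_monom_one)
  next
    fix p q r assume "p \<in> carrier Ore" "q \<in> carrier Ore" "r \<in> carrier Ore"
    then show "p \<otimes>\<^bsub>Ore\<^esub> q \<otimes>\<^bsub>Ore\<^esub> r = p \<otimes>\<^bsub>Ore\<^esub> (q \<otimes>\<^bsub>Ore\<^esub> r)"
      using mult_assoc_S[of p q r] by (simp add: ore_extension_def)
  next
    show "p \<otimes>\<^bsub>Ore\<^esub> q \<in> carrier Ore" if "p \<in> carrier Ore" "q \<in> carrier Ore" for p q
      using that mult_up[of p q] by (simp add: ore_extension_def)
  qed (simp add: ore_extension_def up_one_closed)
  show "(p \<oplus>\<^bsub>Ore\<^esub> q) \<otimes>\<^bsub>Ore\<^esub> r = p \<otimes>\<^bsub>Ore\<^esub> r \<oplus>\<^bsub>Ore\<^esub> q \<otimes>\<^bsub>Ore\<^esub> r"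
    if "p \<in> carrier Ore" "q \<in> carrier Ore" "r \<in> carrier Ore" for p q r
    using that mult_add_left[of p q r] by (simp add: ore_extension_def)
  show "r \<otimes>\<^bsub>Ore\<^esub> (p \<oplus>\<^bsub>Ore\<^esub> q) = r \<otimes>\<^bsub>Ore\<^esub> p \<oplus>\<^bsub>Ore\<^esub> r \<otimes>\<^bsub>Ore\<^esub> q"
    if "p \<in> carrier Ore" "q \<in> carrier Ore" "r \<in> carrier Ore" for p q r
    using that mult_add_right[of r p q] by (simp add: ore_extension_def)
qed

lemma ore_monom_eq:
  assumes "a \<in> carrier R"
  shows "ore_monom R a k = ore_monom R a 0 \<otimes>\<^bsub>Ore\<^esub> (ore_monom R \<one> 1 [^]\<^bsub>Ore\<^esub> k)"
proof -
  interpret Ore: ring Ore by (rule ore_ring)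
  have c: "carrier Ore = up R" by (simp add: ore_extension_def)
  have "ore_monom R \<one> 1 [^]\<^bsub>Ore\<^esub> k = ore_monom R \<one> k"
  proof (induction k)
    case (Suc k)
    have "ore_monom R \<one> 1 [^]\<^bsub>Ore\<^esub> Suc k = ore_monom R \<one> 1 \<otimes>\<^bsub>Ore\<^esub> ore_monom R \<one> k"
      using Ore.nat_pow_Suc2[of "ore_monom R \<one> 1" k] Suc c by simp
    then show ?case by (simp add: mult_monom X_monom_one smult_monom_one)
  qed (simp add: one_S)
  then show ?thesis using assms by (simp add: mult_monom smult_monom_one)
qed

lemma ore_relation:
  assumes "r \<in> carrier R"
  shows "ore_monom R \<one> 1 \<otimes>\<^bsub>Ore\<^esub> ore_monom R r 0
    = ore_monom R (\<sigma> r) 0 \<otimes>\<^bsub>Ore\<^esub> ore_monom R \<one> 1 \<oplus>\<^bsub>Ore\<^esub> ore_monom R (\<delta> r) 0"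
  using assms by (simp add: mult_monom X_monom) (auto simp: ore_extension_def ore_monom_def)

lemma ore_monom_hom: "(\<lambda>r. ore_monom R r 0) \<in> ring_hom R Ore"
  by (rule ring_hom_memI) (auto simp: one_S mult_monom, auto simp: ore_extension_def ore_monom_def up_iff)

end

end

theory Submission
  imports Defs
begin

text \<open>
  Let \<open>S\<close> be the Ore extension. As a left \<open>R\<close>-module it is free on the powers of \<open>x\<close>, and left
  multiplication by \<open>x\<close> raises degrees by at most one. Hence \<open>n\<close> left linear equations in
  \<open>n + 1\<close> unknowns over \<open>S\<close> become, for unknowns of large bounded degree, a left linear system
  over \<open>R\<close> with more unknowns than equations; conversely, the coefficients of a solution over
  \<open>S\<close> of a right linear system over \<open>R\<close> are again solutions. This gives (i) and (iii).
  If \<open>\<sigma>\<close> is an automorphism, \<open>r x = x \<sigma>\<^sup>-\<^sup>1(r) - \<delta>(\<sigma>\<^sup>-\<^sup>1(r))\<close> shows that the opposite rings stand in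
  the same relation, which gives (ii) and (iv).
\<close>

section \<open>Opposite rings\<close>

text \<open>Overwriting only the multiplication field keeps the record type, so finite sums stay
  literally the same and taking the opposite twice gives back the very same record.\<close>

definition op_ring :: "('a, 'm) ring_scheme \<Rightarrow> ('a, 'm) ring_scheme" where
  "op_ring R = R\<lparr>monoid.mult := \<lambda>a b. b \<otimes>\<^bsub>R\<^esub> a\<rparr>"

lemma op_ring_simps [simp]:
  "carrier (op_ring R) = carrier R"
  "a \<otimes>\<^bsub>op_ring R\<^esub> b = b \<otimes>\<^bsub>R\<^esub> a"
  "\<one>\<^bsub>op_ring R\<^esub> = \<one>\<^bsub>R\<^esub>"
  "\<zero>\<^bsub>op_ring R\<^esub> = \<zero>\<^bsub>R\<^esub>"
  "a \<oplus>\<^bsub>op_ring R\<^esub> b = a \<oplus>\<^bsub>R\<^esub> b"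
  by (simp_all add: op_ring_def)

lemma op_ring_op_ring [simp]: "op_ring (op_ring R) = R"
  by (simp add: op_ring_def)

lemma finsum_op_ring [simp]: "finsum (op_ring R) f A = finsum R f A"
  by (simp add: finsum_def op_ring_def)

lemma ring_op_ring:
  assumes "ring R" shows "ring (op_ring R)"
proof -
  interpret ring R by fact
  show ?thesis
  proof (rule ringI)
    show "abelian_group (op_ring R)"
    proof (rule abelian_groupI)
      show "\<exists>y\<in>carrier (op_ring R). y \<oplus>\<^bsub>op_ring R\<^esub> a = \<zero>\<^bsub>op_ring R\<^esub>"
        if "a \<in> carrier (op_ring R)" for a
        using that by (intro bexI[of _ "\<ominus>\<^bsub>R\<^esub> a"]) (auto simp: l_neg)
    qed (auto simp: a_ac)
    show "monoid (op_ring R)"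
      by (rule monoidI) (auto simp: m_assoc)
  qed (auto simp: l_distr r_distr)
qed

lemma nat_pow_op_ring:
  assumes "ring R" "x \<in> carrier R"
  shows "x [^]\<^bsub>op_ring R\<^esub> (k::nat) = x [^]\<^bsub>R\<^esub> k"
proof -
  interpret R: ring R by fact
  interpret P: ring "op_ring R" by (rule ring_op_ring) fact
  show ?thesis
  proof (induction k)
    case (Suc k)
    \<comment> \<open>A power takes its new factor on the right, which in the opposite ring means on
      the left in \<open>R\<close>; \<open>nat_pow_Suc2\<close> reconciles the two.\<close>
    then show ?case unfolding P.nat_pow_Suc R.nat_pow_Suc2[OF assms(2)] by simp
  qed simp
qed

text \<open>Scaling coordinates on the right in \<open>R\<close> is scaling on the left in
  \<open>op_ring R\<close>, while vectors and their sums do not change. From here on only left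
  linear maps are studied.\<close>

lemma right_hom_eq: "right_hom R m n = left_hom (op_ring R) m n"
  unfolding right_hom_def left_hom_def free_mod_def vec_add_def left_smult_def right_smult_def
  by auto

lemma RSRC_eq: "RSRC R \<longleftrightarrow> LSRC (op_ring R)"
  by (simp add: RSRC_def LSRC_def right_hom_eq free_mod_def)


text \<open>Serves \<open>LSRC_lift\<close>: expanding products over \<open>S\<close> yields nested
  sums, whereas the unknowns over \<open>R\<close> are indexed by pairs.\<close>

lemma (in abelian_monoid) finsum_Times:
  assumes "finite A" "finite B" "\<And>a b. a \<in> A \<Longrightarrow> b \<in> B \<Longrightarrow> f (a, b) \<in> carrier G"
  shows "(\<Oplus>\<^bsub>G\<^esub>p\<in>A \<times> B. f p) = (\<Oplus>\<^bsub>G\<^esub>a\<in>A. \<Oplus>\<^bsub>G\<^esub>b\<in>B. f (a, b))"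
  using assms(1,3)
proof (induction A rule: finite_induct)
  case (insert a A)
  have "insert a A \<times> B = Pair a ` B \<union> A \<times> B" by auto
  then have "(\<Oplus>\<^bsub>G\<^esub>p\<in>insert a A \<times> B. f p) = (\<Oplus>\<^bsub>G\<^esub>p\<in>Pair a ` B. f p) \<oplus>\<^bsub>G\<^esub> (\<Oplus>\<^bsub>G\<^esub>p\<in>A \<times> B. f p)"
    using insert(1,2,4) assms(2) by (auto intro!: finsum_Un_disjoint)
  also have "(\<Oplus>\<^bsub>G\<^esub>p\<in>Pair a ` B. f p) = (\<Oplus>\<^bsub>G\<^esub>b\<in>B. f (a, b))"
    using insert(4) by (intro finsum_reindex) (auto simp: inj_on_def)
  also have "(\<Oplus>\<^bsub>G\<^esub>p\<in>A \<times> B. f p) = (\<Oplus>\<^bsub>G\<^esub>a\<in>A. \<Oplus>\<^bsub>G\<^esub>b\<in>B. f (a, b))"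
    using insert by auto
  also have "(\<Oplus>\<^bsub>G\<^esub>b\<in>B. f (a, b)) \<oplus>\<^bsub>G\<^esub> (\<Oplus>\<^bsub>G\<^esub>a\<in>A. \<Oplus>\<^bsub>G\<^esub>b\<in>B. f (a, b))
      = (\<Oplus>\<^bsub>G\<^esub>a\<in>insert a A. \<Oplus>\<^bsub>G\<^esub>b\<in>B. f (a, b))"
    using insert(1,2,4) by (intro finsum_insert[symmetric]) (auto intro!: finsum_closed)
  finally show ?case .
qed simp


section \<open>The strong rank conditions by systems of linear equations\<close>

lemma free_modI:
  "(\<And>i. i < n \<Longrightarrow> v i \<in> carrier R) \<Longrightarrow> (\<And>i. \<not> i < n \<Longrightarrow> v i = undefined) \<Longrightarrow> v \<in> free_mod R n"
  by (auto simp: free_mod_def)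

lemma free_modD:
  "v \<in> free_mod R n \<Longrightarrow> i < n \<Longrightarrow> v i \<in> carrier R"
  "v \<in> free_mod R n \<Longrightarrow> \<not> i < n \<Longrightarrow> v i = undefined"
  by (auto simp: free_mod_def PiE_def extensional_def)

text \<open>Right multiplication by the matrix \<open>A\<close> is a left linear map from
  \<open>R^(n+1)\<close> to \<open>R^n\<close>. By LSRC two distinct vectors share an image, and
  their difference is a nontrivial solution.\<close>

lemma LSRC_square:
  fixes n :: nat
  assumes "ring R" "LSRC R" "n \<ge> 1"
    and A: "\<And>i j. i < n + 1 \<Longrightarrow> j < n \<Longrightarrow> A i j \<in> carrier R"
  obtains v where "\<And>i. i < n + 1 \<Longrightarrow> v i \<in> carrier R" "\<exists>i<n + 1. v i \<noteq> \<zero>\<^bsub>R\<^esub>"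
    "\<And>j. j < n \<Longrightarrow> (\<Oplus>\<^bsub>R\<^esub>i\<in>{..<n + 1}. v i \<otimes>\<^bsub>R\<^esub> A i j) = \<zero>\<^bsub>R\<^esub>"
proof -
  interpret ring R by fact
  define f where "f = (\<lambda>v. \<lambda>j\<in>{..<n}. \<Oplus>\<^bsub>R\<^esub>i\<in>{..<n + 1}. v i \<otimes>\<^bsub>R\<^esub> A i j)"
  have sum_closed: "(\<Oplus>\<^bsub>R\<^esub>i\<in>{..<n + 1}. v i \<otimes>\<^bsub>R\<^esub> A i j) \<in> carrier R"
    if "v \<in> free_mod R (n + 1)" "j < n" for v j
    using that A free_modD(1)[OF that(1)] by (intro finsum_closed) auto
  have add: "(\<Oplus>\<^bsub>R\<^esub>i\<in>{..<n + 1}. vec_add R (n + 1) u v i \<otimes>\<^bsub>R\<^esub> A i j)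
      = (\<Oplus>\<^bsub>R\<^esub>i\<in>{..<n + 1}. u i \<otimes>\<^bsub>R\<^esub> A i j) \<oplus>\<^bsub>R\<^esub> (\<Oplus>\<^bsub>R\<^esub>i\<in>{..<n + 1}. v i \<otimes>\<^bsub>R\<^esub> A i j)"
    if "u \<in> free_mod R (n + 1)" "v \<in> free_mod R (n + 1)" "j < n" for u v j
  proof -
    note uv = free_modD(1)[OF that(1)] free_modD(1)[OF that(2)]
    have "(\<Oplus>\<^bsub>R\<^esub>i\<in>{..<n + 1}. vec_add R (n + 1) u v i \<otimes>\<^bsub>R\<^esub> A i j)
        = (\<Oplus>\<^bsub>R\<^esub>i\<in>{..<n + 1}. u i \<otimes>\<^bsub>R\<^esub> A i j \<oplus>\<^bsub>R\<^esub> v i \<otimes>\<^bsub>R\<^esub> A i j)"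
      using uv A that(3) by (intro finsum_cong') (auto simp: vec_add_def l_distr)
    also have "\<dots> = (\<Oplus>\<^bsub>R\<^esub>i\<in>{..<n + 1}. u i \<otimes>\<^bsub>R\<^esub> A i j) \<oplus>\<^bsub>R\<^esub> (\<Oplus>\<^bsub>R\<^esub>i\<in>{..<n + 1}. v i \<otimes>\<^bsub>R\<^esub> A i j)"
      using uv A that(3) by (intro finsum_addf) auto
    finally show ?thesis .
  qed
  have smult: "(\<Oplus>\<^bsub>R\<^esub>i\<in>{..<n + 1}. left_smult R (n + 1) r v i \<otimes>\<^bsub>R\<^esub> A i j)
      = r \<otimes>\<^bsub>R\<^esub> (\<Oplus>\<^bsub>R\<^esub>i\<in>{..<n + 1}. v i \<otimes>\<^bsub>R\<^esub> A i j)"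
    if "r \<in> carrier R" "v \<in> free_mod R (n + 1)" "j < n" for r v j
  proof -
    note v = free_modD(1)[OF that(2)]
    have "(\<Oplus>\<^bsub>R\<^esub>i\<in>{..<n + 1}. left_smult R (n + 1) r v i \<otimes>\<^bsub>R\<^esub> A i j)
        = (\<Oplus>\<^bsub>R\<^esub>i\<in>{..<n + 1}. r \<otimes>\<^bsub>R\<^esub> (v i \<otimes>\<^bsub>R\<^esub> A i j))"
      using v A that by (intro finsum_cong') (auto simp: left_smult_def m_assoc)
    also have "\<dots> = r \<otimes>\<^bsub>R\<^esub> (\<Oplus>\<^bsub>R\<^esub>i\<in>{..<n + 1}. v i \<otimes>\<^bsub>R\<^esub> A i j)"
      using v A that by (intro finsum_rdistr[symmetric]) auto
    finally show ?thesis .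
  qed
  have "f \<in> left_hom R (n + 1) n"
    unfolding left_hom_def
  proof (intro CollectI conjI ballI funcsetI)
    show "f v \<in> free_mod R n" if "v \<in> free_mod R (n + 1)" for v
      using sum_closed[OF that] by (intro free_modI) (auto simp: f_def)
    show "f (vec_add R (n + 1) u v) = vec_add R n (f u) (f v)"
      if "u \<in> free_mod R (n + 1)" "v \<in> free_mod R (n + 1)" for u v
      using add[OF that] by (intro ext) (auto simp: f_def vec_add_def[of R n])
    show "f (left_smult R (n + 1) r v) = left_smult R n r (f v)"
      if "r \<in> carrier R" "v \<in> free_mod R (n + 1)" for r v
      using smult[OF that] by (intro ext) (auto simp: f_def left_smult_def[of R n])
  qed
  then have "\<not> inj_on f (free_mod R (n + 1))"
    using assms(2,3) unfolding LSRC_def by blast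
  then obtain u w where uw: "u \<in> free_mod R (n + 1)" "w \<in> free_mod R (n + 1)" "u \<noteq> w" "f u = f w"
    by (auto simp: inj_on_def)
  \<comment> \<open>The vector \<open>w'\<close> is minus \<open>w\<close>; writing it as a multiple
    by -1 makes \<open>smult\<close> give its image.\<close>
  define w' where "w' = left_smult R (n + 1) (\<ominus>\<^bsub>R\<^esub> \<one>\<^bsub>R\<^esub>) w"
  have w': "w' \<in> free_mod R (n + 1)"
    using free_modD(1)[OF uw(2)] by (intro free_modI) (auto simp: w'_def left_smult_def)
  have val: "vec_add R (n + 1) u w' i = u i \<ominus>\<^bsub>R\<^esub> w i" if "i < n + 1" for i
    using that free_modD(1)[OF uw(1)] free_modD(1)[OF uw(2)]
    by (simp add: vec_add_def w'_def left_smult_def l_minus minus_eq)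
  show thesis
  proof (rule that[of "vec_add R (n + 1) u w'"])
    show "vec_add R (n + 1) u w' i \<in> carrier R" if "i < n + 1" for i
      using val[OF that] free_modD(1)[OF uw(1) that] free_modD(1)[OF uw(2) that] by simp
    obtain i where i: "u i \<noteq> w i" using uw(3) by auto
    \<comment> \<open>Outside the index range all vectors take the value \<open>undefined\<close>,
      so \<open>u\<close> and \<open>w\<close> can differ only inside it.\<close>
    then have "i < n + 1" using free_modD(2)[OF uw(1)] free_modD(2)[OF uw(2)] by metis
    then show "\<exists>i<n + 1. vec_add R (n + 1) u w' i \<noteq> \<zero>\<^bsub>R\<^esub>"
      using i val free_modD(1)[OF uw(1)] free_modD(1)[OF uw(2)] r_right_minus_eq by metis
    fix j assume j: "j < n"
    define a where "a = (\<Oplus>\<^bsub>R\<^esub>i\<in>{..<n + 1}. w i \<otimes>\<^bsub>R\<^esub> A i j)"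
    have a: "a \<in> carrier R" unfolding a_def by (rule sum_closed[OF uw(2) j])
    have ua: "(\<Oplus>\<^bsub>R\<^esub>i\<in>{..<n + 1}. u i \<otimes>\<^bsub>R\<^esub> A i j) = a"
      using fun_cong[OF uw(4), of j] j by (simp add: f_def a_def)
    have wa: "(\<Oplus>\<^bsub>R\<^esub>i\<in>{..<n + 1}. w' i \<otimes>\<^bsub>R\<^esub> A i j) = (\<ominus>\<^bsub>R\<^esub> \<one>\<^bsub>R\<^esub>) \<otimes>\<^bsub>R\<^esub> a"
      unfolding w'_def a_def by (rule smult[OF _ uw(2) j]) simp
    show "(\<Oplus>\<^bsub>R\<^esub>i\<in>{..<n + 1}. vec_add R (n + 1) u w' i \<otimes>\<^bsub>R\<^esub> A i j) = \<zero>\<^bsub>R\<^esub>"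
      unfolding add[OF uw(1) w' j] ua wa using a by (simp add: l_minus r_neg)
  qed
qed

text \<open>Arbitrary finite index sets are numbered, and the system is padded with trivial
  equations until there is exactly one unknown more than equations, the shape of
  \<open>LSRC_square\<close>. That \<open>J\<close> is nonempty ensures
  \<open>n \<ge> 1\<close>.\<close>

lemma LSRC_solve:
  assumes "ring R" "LSRC R" "finite I" "finite J" "J \<noteq> {}" "card J < card I"
    and A: "\<And>i j. i \<in> I \<Longrightarrow> j \<in> J \<Longrightarrow> A i j \<in> carrier R"
  obtains v where "\<And>i. i \<in> I \<Longrightarrow> v i \<in> carrier R" "\<exists>i\<in>I. v i \<noteq> \<zero>\<^bsub>R\<^esub>"
    "\<And>j. j \<in> J \<Longrightarrow> (\<Oplus>\<^bsub>R\<^esub>i\<in>I. v i \<otimes>\<^bsub>R\<^esub> A i j) = \<zero>\<^bsub>R\<^esub>"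
proof -
  interpret ring R by fact
  define n where "n = card I - 1"
  have J: "0 < card J" using assms(4,5) by (simp add: card_gt_0_iff)
  then have n: "n \<ge> 1" "card I = n + 1" "card J \<le> n" using assms(6) by (auto simp: n_def)
  obtain g where g: "bij_betw g {..<n + 1} I"
    using ex_bij_betw_nat_finite[OF assms(3)] n(2) by (auto simp: atLeast0LessThan)
  obtain h where h: "bij_betw h {..<card J} J"
    using ex_bij_betw_nat_finite[OF assms(4)] by (auto simp: atLeast0LessThan)
  note gI = bij_betwE[OF g, rule_format] and hJ = bij_betwE[OF h, rule_format]
  \<comment> \<open>The columns from \<open>card J\<close> on are zero: equations that every vector
    satisfies.\<close>
  define B where "B i j = (if j < card J then A (g i) (h j) else \<zero>\<^bsub>R\<^esub>)" for i j
  have B: "B i j \<in> carrier R" if "i < n + 1" "j < n" for i j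
    using that gI hJ A by (auto simp: B_def)
  obtain v where v: "\<And>i. i < n + 1 \<Longrightarrow> v i \<in> carrier R" "\<exists>i<n + 1. v i \<noteq> \<zero>\<^bsub>R\<^esub>"
    "\<And>j. j < n \<Longrightarrow> (\<Oplus>\<^bsub>R\<^esub>i\<in>{..<n + 1}. v i \<otimes>\<^bsub>R\<^esub> B i j) = \<zero>\<^bsub>R\<^esub>"
    by (rule LSRC_square[OF assms(1,2) n(1), of B]) (use B that in blast)+
  define g' where "g' = inv_into {..<n + 1} g"
  have g': "g' i < n + 1" "g (g' i) = i" if "i \<in> I" for i
    using that g bij_betw_inv_into_right[OF g that] inv_into_into[of i g "{..<n + 1}"]
    by (auto simp: g'_def bij_betw_def)
  have g'g: "g' (g i) = i" if "i < n + 1" for i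
    using that bij_betw_inv_into_left[OF g] by (simp add: g'_def)
  have I: "I = g ` {..<n + 1}" using g by (simp add: bij_betw_def)
  show thesis
  proof (rule that[of "\<lambda>i. v (g' i)"])
    show "v (g' i) \<in> carrier R" if "i \<in> I" for i using v(1) g'(1) that by blast
    show "\<exists>i\<in>I. v (g' i) \<noteq> \<zero>\<^bsub>R\<^esub>" using v(2) gI g'g by (metis lessThan_iff)
    fix j assume "j \<in> J"
    then obtain k where k: "k < card J" "j = h k" using h by (auto simp: bij_betw_def)
    have "(\<Oplus>\<^bsub>R\<^esub>i\<in>I. v (g' i) \<otimes>\<^bsub>R\<^esub> A i j) = (\<Oplus>\<^bsub>R\<^esub>i\<in>{..<n + 1}. v (g' (g i)) \<otimes>\<^bsub>R\<^esub> A (g i) j)"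
      unfolding I using g v(1) g'(1) A \<open>j \<in> J\<close> I
      by (intro add.finprod_reindex) (auto simp: bij_betw_def)
    also have "\<dots> = (\<Oplus>\<^bsub>R\<^esub>i\<in>{..<n + 1}. v i \<otimes>\<^bsub>R\<^esub> B i k)"
      using v(1) A gI \<open>j \<in> J\<close> k n(3) g'g by (intro finsum_cong') (auto simp: B_def)
    also have "\<dots> = \<zero>\<^bsub>R\<^esub>" using v(3) k n(3) by simp
    finally show "(\<Oplus>\<^bsub>R\<^esub>i\<in>I. v (g' i) \<otimes>\<^bsub>R\<^esub> A i j) = \<zero>\<^bsub>R\<^esub>" .
  qed
qed

text \<open>The rows of the matrix of \<open>f\<close> are the images of the unit vectors. The
  induction builds \<open>v\<close> one coordinate at a time, through truncations \<open>t k\<close>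
  whose entries from index \<open>k\<close> on are zero.\<close>

lemma left_hom_eq_sum:
  assumes "ring R" and f: "f \<in> left_hom R m n" and v: "v \<in> free_mod R m" and j: "j < n"
  shows "f v j = (\<Oplus>\<^bsub>R\<^esub>i\<in>{..<m}. v i \<otimes>\<^bsub>R\<^esub> f (\<lambda>k\<in>{..<m}. if k = i then \<one>\<^bsub>R\<^esub> else \<zero>\<^bsub>R\<^esub>) j)"
proof -
  interpret ring R by fact
  define e where "e i = (\<lambda>k\<in>{..<m}. if k = i then \<one>\<^bsub>R\<^esub> else \<zero>\<^bsub>R\<^esub>)" for i
  define t where "t k = (\<lambda>i\<in>{..<m}. if i < k then v i else \<zero>\<^bsub>R\<^esub>)" for k
  note vc = free_modD(1)[OF v]
  have fc: "f u \<in> free_mod R n" if "u \<in> free_mod R m" for u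
    using f that by (auto simp: left_hom_def)
  have fadd: "f (vec_add R m u w) = vec_add R n (f u) (f w)"
    if "u \<in> free_mod R m" "w \<in> free_mod R m" for u w
    using f that by (auto simp: left_hom_def)
  have fsm: "f (left_smult R m r u) = left_smult R n r (f u)"
    if "r \<in> carrier R" "u \<in> free_mod R m" for r u
    using f that by (auto simp: left_hom_def)
  have e: "e i \<in> free_mod R m" for i by (auto simp: e_def intro: free_modI)
  have t: "t k \<in> free_mod R m" for k using vc by (auto simp: t_def intro: free_modI)
  have fe: "f (e i) j \<in> carrier R" for i using free_modD(1)[OF fc[OF e] j] .
  have "f (t k) j = (\<Oplus>\<^bsub>R\<^esub>i\<in>{..<k}. v i \<otimes>\<^bsub>R\<^esub> f (e i) j)" if "k \<le> m" for k
    using that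
  proof (induction k)
    case 0
    \<comment> \<open>The zero vector is zero times itself, so linearity forces its image to
      vanish.\<close>
    have "left_smult R m \<zero>\<^bsub>R\<^esub> (t 0) = t 0"
      by (intro ext) (auto simp: left_smult_def t_def)
    then have "f (t 0) j = left_smult R n \<zero>\<^bsub>R\<^esub> (f (t 0)) j" using fsm[OF _ t, of "\<zero>\<^bsub>R\<^esub>" 0] by simp
    then show ?case using free_modD(1)[OF fc[OF t] j] j by (simp add: left_smult_def)
  next
    case (Suc k)
    have sm: "left_smult R m (v k) (e k) \<in> free_mod R m"
      using vc Suc.prems by (intro free_modI) (auto simp: left_smult_def e_def)
    have "t (Suc k) = vec_add R m (left_smult R m (v k) (e k)) (t k)"
      using vc Suc.prems
      by (intro ext) (auto simp: t_def vec_add_def left_smult_def e_def less_Suc_eq)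
    then have "f (t (Suc k)) j = v k \<otimes>\<^bsub>R\<^esub> f (e k) j \<oplus>\<^bsub>R\<^esub> f (t k) j"
      using fadd[OF sm t, of k] fsm[OF _ e, of "v k" k] vc Suc.prems j
      by (simp add: vec_add_def[of R n] left_smult_def[of R n])
    then show ?case
      using Suc vc fe by (simp add: lessThan_Suc add.finprod_insert Pi_def)
  qed
  moreover have "t m = v" using free_modD(2)[OF v] by (intro ext) (auto simp: t_def)
  ultimately show ?thesis by (auto simp: e_def)
qed

text \<open>Converse of \<open>LSRC_square\<close>: a nontrivial solution for the matrix of an
  injective \<open>f\<close> would have the same image as the zero vector.\<close>

lemma LSRC_I:
  assumes "ring R"
    and solve: "\<And>(n::nat) A. n \<ge> 1 \<Longrightarrow> (\<And>i j. i < n + 1 \<Longrightarrow> j < n \<Longrightarrow> A i j \<in> carrier R) \<Longrightarrow>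
      \<exists>v. (\<forall>i<n + 1. v i \<in> carrier R) \<and> (\<exists>i<n + 1. v i \<noteq> \<zero>\<^bsub>R\<^esub>) \<and>
        (\<forall>j<n. (\<Oplus>\<^bsub>R\<^esub>i\<in>{..<n + 1}. v i \<otimes>\<^bsub>R\<^esub> A i j) = \<zero>\<^bsub>R\<^esub>)"
  shows "LSRC R"
  unfolding LSRC_def
proof (intro allI impI notI)
  interpret ring R by fact
  fix n :: nat assume n: "1 \<le> n"
  assume "\<exists>f\<in>left_hom R (n + 1) n. inj_on f (free_mod R (n + 1))"
  then obtain f where f: "f \<in> left_hom R (n + 1) n" and inj: "inj_on f (free_mod R (n + 1))"
    by blast
  have fc: "f u \<in> free_mod R n" if "u \<in> free_mod R (n + 1)" for u
    using f that by (auto simp: left_hom_def)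
  define A where "A i j = f (\<lambda>k\<in>{..<n + 1}. if k = i then \<one>\<^bsub>R\<^esub> else \<zero>\<^bsub>R\<^esub>) j" for i j
  have A: "A i j \<in> carrier R" if "j < n" for i j
    unfolding A_def using that by (intro free_modD(1)[OF fc] free_modI) auto
  have fA: "f u j = (\<Oplus>\<^bsub>R\<^esub>i\<in>{..<n + 1}. u i \<otimes>\<^bsub>R\<^esub> A i j)"
    if "u \<in> free_mod R (n + 1)" "j < n" for u j
    unfolding A_def by (rule left_hom_eq_sum[OF assms(1) f that])
  obtain v where v: "\<And>i. i < n + 1 \<Longrightarrow> v i \<in> carrier R" "\<exists>i<n + 1. v i \<noteq> \<zero>\<^bsub>R\<^esub>"
    "\<And>j. j < n \<Longrightarrow> (\<Oplus>\<^bsub>R\<^esub>i\<in>{..<n + 1}. v i \<otimes>\<^bsub>R\<^esub> A i j) = \<zero>\<^bsub>R\<^esub>"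
    using solve[OF n, of A] A by blast
  \<comment> \<open>Nothing is known of \<open>v\<close> outside the index range; it must be cut off
    there to be an element of the free module.\<close>
  define w where "w = (\<lambda>i\<in>{..<n + 1}. v i)"
  define z where "z = (\<lambda>i\<in>{..<n + 1}. \<zero>\<^bsub>R\<^esub>)"
  have w: "w \<in> free_mod R (n + 1)" using v(1) by (intro free_modI) (auto simp: w_def)
  have z: "z \<in> free_mod R (n + 1)" by (intro free_modI) (auto simp: z_def)
  have "f w j = f z j" for j
  proof (cases "j < n")
    case True
    have "f w j = (\<Oplus>\<^bsub>R\<^esub>i\<in>{..<n + 1}. v i \<otimes>\<^bsub>R\<^esub> A i j)"
      unfolding fA[OF w True] using v(1) A True by (intro finsum_cong') (auto simp: w_def)
    moreover have "f z j = (\<Oplus>\<^bsub>R\<^esub>i\<in>{..<n + 1}. \<zero>\<^bsub>R\<^esub>)"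
      unfolding fA[OF z True] using A True by (intro finsum_cong') (auto simp: z_def)
    ultimately show ?thesis using v(3)[OF True] by (simp del: lessThan_Suc)
  next
    case False
    then show ?thesis using free_modD(2)[OF fc[OF w]] free_modD(2)[OF fc[OF z]] by simp
  qed
  then have "w = z" using inj_onD[OF inj _ w z] by blast
  moreover obtain i where "i < n + 1" "v i \<noteq> \<zero>\<^bsub>R\<^esub>" using v(2) by blast
  ultimately show False unfolding w_def z_def by (metis lessThan_iff restrict_apply')
qed


section \<open>Rings with a basis of powers of a twisting element\<close>

text \<open>Abstracting from the Ore extension lets one argument serve both the given rings and
  their opposites. On the opposite side \<open>s\<close> and \<open>t\<close> will be
  \<open>\<sigma>^-1(r)\<close> and \<open>-\<delta>(\<sigma>^-1(r))\<close>, so the relation asks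
  only that some such elements exist.\<close>

locale twisting_element = R: ring R + S: ring S
  for R :: "('a, 'm) ring_scheme" and S :: "('b, 'k) ring_scheme" +
  fixes \<phi> :: "'a \<Rightarrow> 'b" and x :: 'b
  assumes hom: "\<phi> \<in> ring_hom R S"
    and x_closed [simp]: "x \<in> carrier S"
    and twist: "r \<in> carrier R \<Longrightarrow>
      \<exists>s\<in>carrier R. \<exists>t\<in>carrier R. x \<otimes>\<^bsub>S\<^esub> \<phi> r = \<phi> s \<otimes>\<^bsub>S\<^esub> x \<oplus>\<^bsub>S\<^esub> \<phi> t"
begin

lemma phi_simps [simp]:
  "r \<in> carrier R \<Longrightarrow> \<phi> r \<in> carrier S"
  "r \<in> carrier R \<Longrightarrow> s \<in> carrier R \<Longrightarrow> \<phi> (r \<oplus>\<^bsub>R\<^esub> s) = \<phi> r \<oplus>\<^bsub>S\<^esub> \<phi> s"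
  "r \<in> carrier R \<Longrightarrow> s \<in> carrier R \<Longrightarrow> \<phi> (r \<otimes>\<^bsub>R\<^esub> s) = \<phi> r \<otimes>\<^bsub>S\<^esub> \<phi> s"
  "\<phi> \<one>\<^bsub>R\<^esub> = \<one>\<^bsub>S\<^esub>" "\<phi> \<zero>\<^bsub>R\<^esub> = \<zero>\<^bsub>S\<^esub>"
  using hom R.ring_axioms S.ring_axioms
  by (auto simp: ring_hom_closed ring_hom_add ring_hom_mult ring_hom_one ring_hom_zero)

section \<open>Combinations of powers of \<open>x\<close> of bounded degree\<close>

definition comb :: "nat \<Rightarrow> (nat \<Rightarrow> 'a) \<Rightarrow> 'b" where
  "comb d r = (\<Oplus>\<^bsub>S\<^esub>l\<in>{..d}. \<phi> (r l) \<otimes>\<^bsub>S\<^esub> x [^]\<^bsub>S\<^esub> l)"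

text \<open>Membership in \<open>span d\<close> replaces having degree at most \<open>d\<close>;
  this makes sense before the powers of \<open>x\<close> are known to be independent.\<close>

definition span :: "nat \<Rightarrow> 'b set" where
  "span d = comb d ` (UNIV \<rightarrow> carrier R)"

lemma comb_closed [simp]: "r \<in> UNIV \<rightarrow> carrier R \<Longrightarrow> comb d r \<in> carrier S"
  unfolding comb_def by (intro S.finsum_closed) (auto simp: Pi_def)

lemma span_closed: "s \<in> span d \<Longrightarrow> s \<in> carrier S"
  by (auto simp: span_def)

lemma comb_cong:
  assumes "r \<in> UNIV \<rightarrow> carrier R" "\<And>l. l \<le> d \<Longrightarrow> q l = r l"
  shows "comb d q = comb d r"
  unfolding comb_def using assms by (intro S.finsum_cong') (auto simp: Pi_def)

lemma comb_zero: "comb d (\<lambda>l. \<zero>\<^bsub>R\<^esub>) = \<zero>\<^bsub>S\<^esub>"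
  by (simp add: comb_def)

lemma comb_add:
  assumes "r \<in> UNIV \<rightarrow> carrier R" "q \<in> UNIV \<rightarrow> carrier R"
  shows "comb d r \<oplus>\<^bsub>S\<^esub> comb d q = comb d (\<lambda>l. r l \<oplus>\<^bsub>R\<^esub> q l)"
  unfolding comb_def using assms
  by (subst S.finsum_addf[symmetric]) (auto simp: Pi_def S.l_distr intro!: S.finsum_cong')

lemma comb_smult:
  assumes "a \<in> carrier R" "r \<in> UNIV \<rightarrow> carrier R"
  shows "\<phi> a \<otimes>\<^bsub>S\<^esub> comb d r = comb d (\<lambda>l. a \<otimes>\<^bsub>R\<^esub> r l)"
  unfolding comb_def using assms
  by (subst S.finsum_rdistr) (auto simp: Pi_def S.m_assoc intro!: S.finsum_cong')

lemma comb_finsum: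
  assumes "finite I" "\<And>i. i \<in> I \<Longrightarrow> r i \<in> UNIV \<rightarrow> carrier R"
  shows "(\<Oplus>\<^bsub>S\<^esub>i\<in>I. comb d (r i)) = comb d (\<lambda>l. \<Oplus>\<^bsub>R\<^esub>i\<in>I. r i l)"
  using assms
proof (induction I rule: finite_induct)
  case empty
  then show ?case by (simp add: comb_zero)
next
  case (insert i I)
  have r: "r k l \<in> carrier R" if "k \<in> insert i I" for k l
    using insert.prems[OF that] by auto
  have "(\<Oplus>\<^bsub>S\<^esub>i\<in>insert i I. comb d (r i)) = comb d (r i) \<oplus>\<^bsub>S\<^esub> comb d (\<lambda>l. \<Oplus>\<^bsub>R\<^esub>i\<in>I. r i l)"
    using insert by (simp add: S.add.finprod_insert Pi_def)
  also have "\<dots> = comb d (\<lambda>l. r i l \<oplus>\<^bsub>R\<^esub> (\<Oplus>\<^bsub>R\<^esub>i\<in>I. r i l))"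
    using r by (intro comb_add) (auto intro!: R.finsum_closed)
  also have "\<dots> = comb d (\<lambda>l. \<Oplus>\<^bsub>R\<^esub>i\<in>insert i I. r i l)"
    using insert(1,2) r by (simp add: R.add.finprod_insert Pi_def)
  finally show ?case .
qed

lemma span_add: "s \<in> span d \<Longrightarrow> t \<in> span d \<Longrightarrow> s \<oplus>\<^bsub>S\<^esub> t \<in> span d"
  by (auto simp: span_def comb_add Pi_def intro!: imageI)

lemma span_zero: "\<zero>\<^bsub>S\<^esub> \<in> span d"
  unfolding span_def by (rule image_eqI[where x = "\<lambda>l. \<zero>\<^bsub>R\<^esub>"]) (simp_all add: comb_zero)

lemma span_finsum:
  "finite I \<Longrightarrow> (\<And>i. i \<in> I \<Longrightarrow> f i \<in> span d) \<Longrightarrow> (\<Oplus>\<^bsub>S\<^esub>i\<in>I. f i) \<in> span d"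
proof (induction I rule: finite_induct)
  case (insert i I)
  then have "f i \<in> carrier S" "f \<in> I \<rightarrow> carrier S" using span_closed by auto
  then show ?case using insert by (simp add: span_add)
qed (simp add: span_zero)

lemma span_monom:
  assumes "a \<in> carrier R" "l \<le> d"
  shows "\<phi> a \<otimes>\<^bsub>S\<^esub> x [^]\<^bsub>S\<^esub> l \<in> span d"
proof -
  have "comb d (\<lambda>k. if k = l then a else \<zero>\<^bsub>R\<^esub>)
      = (\<Oplus>\<^bsub>S\<^esub>k\<in>{..d}. if l = k then \<phi> a \<otimes>\<^bsub>S\<^esub> x [^]\<^bsub>S\<^esub> k else \<zero>\<^bsub>S\<^esub>)"
    unfolding comb_def using assms by (intro S.finsum_cong') auto
  also have "\<dots> = \<phi> a \<otimes>\<^bsub>S\<^esub> x [^]\<^bsub>S\<^esub> l"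
    using assms by (intro S.finsum_singleton) auto
  finally show ?thesis
    unfolding span_def using assms by (intro image_eqI[OF sym]) auto
qed

lemma span_mono: "d \<le> e \<Longrightarrow> span d \<subseteq> span e"
proof
  fix s assume de: "d \<le> e" and "s \<in> span d"
  then obtain r where r: "r \<in> UNIV \<rightarrow> carrier R" "s = comb d r" unfolding span_def by blast
  show "s \<in> span e"
    unfolding r(2) comb_def using r(1) de by (intro span_finsum span_monom) auto
qed

text \<open>Moving \<open>x\<close> across a coefficient yields one term with an additional factor
  \<open>x\<close> and one correction term without it, so the degree bound rises by at most
  one.\<close>

lemma x_span:
  assumes "s \<in> span d"
  shows "x \<otimes>\<^bsub>S\<^esub> s \<in> span (Suc d)"
proof -
  obtain r where r': "r \<in> UNIV \<rightarrow> carrier R" "s = comb d r"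
    using assms unfolding span_def by blast
  then have r: "\<And>l. r l \<in> carrier R" by auto
  have "x \<otimes>\<^bsub>S\<^esub> (\<phi> (r l) \<otimes>\<^bsub>S\<^esub> x [^]\<^bsub>S\<^esub> l) \<in> span (Suc d)" if l: "l \<le> d" for l
  proof -
    obtain a b where ab: "a \<in> carrier R" "b \<in> carrier R"
      and e: "x \<otimes>\<^bsub>S\<^esub> \<phi> (r l) = \<phi> a \<otimes>\<^bsub>S\<^esub> x \<oplus>\<^bsub>S\<^esub> \<phi> b"
      using twist[OF r] by blast
    have "x \<otimes>\<^bsub>S\<^esub> (\<phi> (r l) \<otimes>\<^bsub>S\<^esub> x [^]\<^bsub>S\<^esub> l) = (\<phi> a \<otimes>\<^bsub>S\<^esub> x \<oplus>\<^bsub>S\<^esub> \<phi> b) \<otimes>\<^bsub>S\<^esub> x [^]\<^bsub>S\<^esub> l"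
      using r by (simp add: S.m_assoc flip: e)
    also have "\<dots> = \<phi> a \<otimes>\<^bsub>S\<^esub> x [^]\<^bsub>S\<^esub> Suc l \<oplus>\<^bsub>S\<^esub> \<phi> b \<otimes>\<^bsub>S\<^esub> x [^]\<^bsub>S\<^esub> l"
      unfolding S.nat_pow_Suc2[OF x_closed] using ab by (simp add: S.l_distr S.m_assoc)
    also have "\<dots> \<in> span (Suc d)"
      using ab l by (intro span_add span_monom) auto
    finally show ?thesis .
  qed
  moreover have "x \<otimes>\<^bsub>S\<^esub> s = (\<Oplus>\<^bsub>S\<^esub>l\<in>{..d}. x \<otimes>\<^bsub>S\<^esub> (\<phi> (r l) \<otimes>\<^bsub>S\<^esub> x [^]\<^bsub>S\<^esub> l))"
    unfolding r'(2) comb_def using r by (intro S.finsum_rdistr) auto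
  ultimately show ?thesis by (auto intro!: span_finsum)
qed

lemma pow_span: "s \<in> span d \<Longrightarrow> x [^]\<^bsub>S\<^esub> l \<otimes>\<^bsub>S\<^esub> s \<in> span (d + l)"
proof (induction l)
  case (Suc l)
  have "x [^]\<^bsub>S\<^esub> Suc l \<otimes>\<^bsub>S\<^esub> s = x \<otimes>\<^bsub>S\<^esub> (x [^]\<^bsub>S\<^esub> l \<otimes>\<^bsub>S\<^esub> s)"
    unfolding S.nat_pow_Suc2[OF x_closed] using span_closed[OF Suc.prems] by (simp add: S.m_assoc)
  then show ?case using x_span Suc by simp
qed (simp add: span_closed)

end

text \<open>The two assumptions say that \<open>S\<close> is free as a left \<open>R\<close>-module
  on the powers of \<open>x\<close>.\<close>

locale power_basis = twisting_element +
  assumes spans: "s \<in> carrier S \<Longrightarrow> \<exists>d. s \<in> span d"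
    and independent: "\<lbrakk>r \<in> UNIV \<rightarrow> carrier R; comb d r = \<zero>\<^bsub>S\<^esub>; l \<le> d\<rbrakk> \<Longrightarrow> r l = \<zero>\<^bsub>R\<^esub>"
begin

section \<open>Transfer of the strong rank conditions along a basis of powers\<close>

lemma common_span:
  assumes "finite I" "\<And>i. i \<in> I \<Longrightarrow> f i \<in> carrier S"
  obtains d where "\<And>i. i \<in> I \<Longrightarrow> f i \<in> span d"
proof -
  obtain e where e: "\<And>i. i \<in> I \<Longrightarrow> f i \<in> span (e i)" 
  proof -
    have "\<forall>i\<in>I. \<exists>d. f i \<in> span d" using spans assms(2) by blast
    from bchoice[OF this] show thesis using that by blast
  qed
  \<comment> \<open>The sum of the finitely many bounds is a common bound; unlike a maximum it also
    makes sense for empty \<open>I\<close>.\<close>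
  have "f i \<in> span (sum e I)" if "i \<in> I" for i
    using e[OF that] span_mono[of "e i" "sum e I"] member_le_sum[OF that, of e] assms(1) by auto
  then show thesis using that by blast
qed

text \<open>
  Give the \<open>n + 1\<close> unknowns degree at most \<open>k = n d\<close>, where \<open>d\<close> bounds the degrees of the
  system: comparing coefficients leaves \<open>(n + 1)(k + 1)\<close> unknowns over \<open>R\<close> and only
  \<open>n (d + k + 1) = (n + 1)(k + 1) - 1\<close> equations.
\<close>

lemma LSRC_lift:
  assumes "LSRC R" shows "LSRC S"
proof (rule LSRC_I[OF S.ring_axioms])
  fix n :: nat and A assume n: "1 \<le> n"
    and A: "\<And>i j. i < n + 1 \<Longrightarrow> j < n \<Longrightarrow> A i j \<in> carrier S"
  obtain d where "\<And>p. p \<in> {..<n + 1} \<times> {..<n} \<Longrightarrow> case_prod A p \<in> span d"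
    by (rule common_span[of "{..<n + 1} \<times> {..<n}" "case_prod A"]) (use A in auto)
  then have d: "A i j \<in> span d" if "i < n + 1" "j < n" for i j
    using that by force
  define k where "k = n * d"
  define I where "I = {..<n + 1} \<times> {..k}"
  define J where "J = {..<n} \<times> {..d + k}"
  \<comment> \<open>The unknowns will be sums of terms \<open>r x^l\<close>. Expanding
    \<open>x^l A i j\<close> with coefficients on the left therefore leaves each \<open>r\<close>
    leftmost, as a left linear system over \<open>R\<close> requires.\<close>
  have "\<exists>c. c \<in> UNIV \<rightarrow> carrier R \<and> x [^]\<^bsub>S\<^esub> l \<otimes>\<^bsub>S\<^esub> A i j = comb (d + k) c"
    if "i < n + 1" "j < n" "l \<le> k" for i j l
  proof -
    have "x [^]\<^bsub>S\<^esub> l \<otimes>\<^bsub>S\<^esub> A i j \<in> span (d + k)"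
      using pow_span[OF d[OF that(1,2)], of l] span_mono[of "d + l" "d + k"] that(3) by auto
    then show ?thesis unfolding span_def by blast
  qed
  then obtain c where c: "\<And>i j l. i < n + 1 \<Longrightarrow> j < n \<Longrightarrow> l \<le> k \<Longrightarrow>
      c i j l \<in> UNIV \<rightarrow> carrier R \<and> x [^]\<^bsub>S\<^esub> l \<otimes>\<^bsub>S\<^esub> A i j = comb (d + k) (c i j l)"
    by metis
  \<comment> \<open>Unknown \<open>(i, l)\<close> is the coefficient of \<open>x^l\<close> in
    \<open>v i\<close>; equation \<open>(j, m)\<close> is the coefficient of \<open>x^m\<close> in
    the \<open>j\<close>-th equation over \<open>S\<close>.\<close>
  define B where "B p q = (case p of (i, l) \<Rightarrow> case q of (j, m) \<Rightarrow> c i j l m)" for p q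
  have B: "B p q \<in> carrier R" if "p \<in> I" "q \<in> J" for p q
    using that c by (auto simp: B_def I_def J_def Pi_def)
  have "card J < card I" by (simp add: I_def J_def k_def algebra_simps)
  moreover have "finite I" "finite J" "J \<noteq> {}"
    using n by (auto simp: I_def J_def lessThan_empty_iff bot_nat_def)
  ultimately obtain r where r: "\<And>p. p \<in> I \<Longrightarrow> r p \<in> carrier R" "\<exists>p\<in>I. r p \<noteq> \<zero>\<^bsub>R\<^esub>"
    "\<And>q. q \<in> J \<Longrightarrow> (\<Oplus>\<^bsub>R\<^esub>p\<in>I. r p \<otimes>\<^bsub>R\<^esub> B p q) = \<zero>\<^bsub>R\<^esub>"
    using LSRC_solve[OF R.ring_axioms assms, of I J B] B by blast
  \<comment> \<open>Only the values of \<open>r\<close> on \<open>I\<close> are known to lie in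
    \<open>R\<close>, while \<open>comb\<close> is handled for sequences entirely in the carrier;
    hence the zeros beyond \<open>k\<close>.\<close>
  define r' where "r' i l = (if l \<le> k then r (i, l) else \<zero>\<^bsub>R\<^esub>)" for i l
  have r': "r' i \<in> UNIV \<rightarrow> carrier R" if "i < n + 1" for i
    using r(1) that by (auto simp: r'_def I_def)
  define v where "v i = comb k (r' i)" for i
  have "v i \<in> carrier S" if "i < n + 1" for i using r'[OF that] by (simp add: v_def)
  moreover have "\<exists>i<n + 1. v i \<noteq> \<zero>\<^bsub>S\<^esub>"
  proof -
    obtain i l where il: "i < n + 1" "l \<le> k" "r (i, l) \<noteq> \<zero>\<^bsub>R\<^esub>" using r(2) by (auto simp: I_def)
    then have "v i \<noteq> \<zero>\<^bsub>S\<^esub>" using independent[OF r'[OF il(1)], of k l] by (auto simp: v_def r'_def)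
    then show ?thesis using il by blast
  qed
  moreover have "(\<Oplus>\<^bsub>S\<^esub>i\<in>{..<n + 1}. v i \<otimes>\<^bsub>S\<^esub> A i j) = \<zero>\<^bsub>S\<^esub>" if j: "j < n" for j
  proof -
    have cc: "c i j l m \<in> carrier R" if "i < n + 1" "l \<le> k" for i l m
      using c[OF that(1) j that(2)] by auto
    have rc: "r (i, l) \<in> carrier R" if "i < n + 1" "l \<le> k" for i l
      using r(1) that by (auto simp: I_def)
    have vA: "v i \<otimes>\<^bsub>S\<^esub> A i j = comb (d + k) (\<lambda>m. \<Oplus>\<^bsub>R\<^esub>l\<in>{..k}. r (i, l) \<otimes>\<^bsub>R\<^esub> c i j l m)"
      if i: "i < n + 1" for i
    proof -
      have "v i \<otimes>\<^bsub>S\<^esub> A i j = (\<Oplus>\<^bsub>S\<^esub>l\<in>{..k}. (\<phi> (r' i l) \<otimes>\<^bsub>S\<^esub> x [^]\<^bsub>S\<^esub> l) \<otimes>\<^bsub>S\<^esub> A i j)"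
        unfolding v_def comb_def using r'[OF i] A[OF i j] by (intro S.finsum_ldistr) (auto simp: Pi_def)
      also have "\<dots> = (\<Oplus>\<^bsub>S\<^esub>l\<in>{..k}. comb (d + k) (\<lambda>m. r (i, l) \<otimes>\<^bsub>R\<^esub> c i j l m))"
      proof (rule S.finsum_cong')
        fix l assume "l \<in> {..k}"
        then have l: "l \<le> k" by simp
        have "(\<phi> (r' i l) \<otimes>\<^bsub>S\<^esub> x [^]\<^bsub>S\<^esub> l) \<otimes>\<^bsub>S\<^esub> A i j = \<phi> (r (i, l)) \<otimes>\<^bsub>S\<^esub> comb (d + k) (c i j l)"
          using c[OF i j l] rc[OF i l] A[OF i j] l by (simp add: r'_def S.m_assoc)
        then show "(\<phi> (r' i l) \<otimes>\<^bsub>S\<^esub> x [^]\<^bsub>S\<^esub> l) \<otimes>\<^bsub>S\<^esub> A i j = comb (d + k) (\<lambda>m. r (i, l) \<otimes>\<^bsub>R\<^esub> c i j l m)"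
          using c[OF i j l] rc[OF i l] by (simp add: comb_smult)
      qed (use rc[OF i] cc[OF i] in auto)
      also have "\<dots> = comb (d + k) (\<lambda>m. \<Oplus>\<^bsub>R\<^esub>l\<in>{..k}. r (i, l) \<otimes>\<^bsub>R\<^esub> c i j l m)"
        using rc[OF i] cc[OF i] by (intro comb_finsum) auto
      finally show ?thesis .
    qed
    have "(\<Oplus>\<^bsub>S\<^esub>i\<in>{..<n + 1}. v i \<otimes>\<^bsub>S\<^esub> A i j)
        = (\<Oplus>\<^bsub>S\<^esub>i\<in>{..<n + 1}. comb (d + k) (\<lambda>m. \<Oplus>\<^bsub>R\<^esub>l\<in>{..k}. r (i, l) \<otimes>\<^bsub>R\<^esub> c i j l m))"
      using vA rc cc by (intro S.finsum_cong') (auto intro!: comb_closed R.finsum_closed)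
    also have "\<dots> = comb (d + k) (\<lambda>m. \<Oplus>\<^bsub>R\<^esub>i\<in>{..<n + 1}. \<Oplus>\<^bsub>R\<^esub>l\<in>{..k}. r (i, l) \<otimes>\<^bsub>R\<^esub> c i j l m)"
      using rc cc by (intro comb_finsum) (auto intro!: R.finsum_closed)
    also have "\<dots> = comb (d + k) (\<lambda>m. \<zero>\<^bsub>R\<^esub>)"
    proof (rule comb_cong)
      fix m assume m: "m \<le> d + k"
      have "(\<Oplus>\<^bsub>R\<^esub>i\<in>{..<n + 1}. \<Oplus>\<^bsub>R\<^esub>l\<in>{..k}. r (i, l) \<otimes>\<^bsub>R\<^esub> c i j l m)
          = (\<Oplus>\<^bsub>R\<^esub>p\<in>I. r p \<otimes>\<^bsub>R\<^esub> B p (j, m))"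
        unfolding I_def using rc cc
        by (subst R.finsum_Times) (auto simp: B_def intro!: R.finsum_closed R.finsum_cong')
      also have "\<dots> = \<zero>\<^bsub>R\<^esub>" using j m by (intro r(3)) (auto simp: J_def)
      finally show "(\<Oplus>\<^bsub>R\<^esub>i\<in>{..<n + 1}. \<Oplus>\<^bsub>R\<^esub>l\<in>{..k}. r (i, l) \<otimes>\<^bsub>R\<^esub> c i j l m) = \<zero>\<^bsub>R\<^esub>" .
    qed simp
    finally show ?thesis by (simp add: comb_zero)
  qed
  ultimately show "\<exists>v. (\<forall>i<n + 1. v i \<in> carrier S) \<and> (\<exists>i<n + 1. v i \<noteq> \<zero>\<^bsub>S\<^esub>) \<and>
      (\<forall>j<n. (\<Oplus>\<^bsub>S\<^esub>i\<in>{..<n + 1}. v i \<otimes>\<^bsub>S\<^esub> A i j) = \<zero>\<^bsub>S\<^esub>)" by blast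
qed

text \<open>Over the opposite rings the unknowns stand on the right of the coefficients. Left
  multiplication by \<open>\<phi> (A i j)\<close> acts on each coefficient of \<open>v i\<close>
  separately, without crossing \<open>x\<close>, so by independence the coefficients at any fixed
  power of \<open>x\<close> solve the system over \<open>R\<close>.\<close>

lemma RSRC_descend:
  assumes "RSRC S" shows "RSRC R"
  unfolding RSRC_eq
proof (rule LSRC_I[OF ring_op_ring[OF R.ring_axioms]], unfold op_ring_simps finsum_op_ring)
  fix n :: nat and A assume n: "1 \<le> n"
    and A: "\<And>i j. i < n + 1 \<Longrightarrow> j < n \<Longrightarrow> A i j \<in> carrier R"
  have L: "LSRC (op_ring S)" using assms by (simp add: RSRC_eq)
  have A': "\<phi> (A i j) \<in> carrier (op_ring S)" if "i < n + 1" "j < n" for i j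
    using A[OF that] by simp
  obtain v where v: "\<And>i. i < n + 1 \<Longrightarrow> v i \<in> carrier S" "\<exists>i<n + 1. v i \<noteq> \<zero>\<^bsub>S\<^esub>"
    "\<And>j. j < n \<Longrightarrow> (\<Oplus>\<^bsub>S\<^esub>i\<in>{..<n + 1}. \<phi> (A i j) \<otimes>\<^bsub>S\<^esub> v i) = \<zero>\<^bsub>S\<^esub>"
    by (rule LSRC_square[OF ring_op_ring[OF S.ring_axioms] L n, of "\<lambda>i j. \<phi> (A i j)"],
        unfold op_ring_simps finsum_op_ring) (use A' that in auto)
  obtain d where "\<And>i. i < n + 1 \<Longrightarrow> v i \<in> span d"
    using common_span[of "{..<n + 1}" v] v(1) by auto
  then have "\<forall>i. \<exists>r. i < n + 1 \<longrightarrow> r \<in> UNIV \<rightarrow> carrier R \<and> v i = comb d r"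
    unfolding span_def by blast
  then obtain r where r: "\<And>i. i < n + 1 \<Longrightarrow> r i \<in> UNIV \<rightarrow> carrier R"
    "\<And>i. i < n + 1 \<Longrightarrow> v i = comb d (r i)"
    by metis
  have rc: "r i l \<in> carrier R" if "i < n + 1" for i l using r(1)[OF that] by auto
  \<comment> \<open>Some unknown has a nonzero coefficient; the power \<open>l\<close> at which it
    occurs selects a nontrivial solution over \<open>R\<close>.\<close>
  obtain i l where il: "i < n + 1" "l \<le> d" "r i l \<noteq> \<zero>\<^bsub>R\<^esub>"
  proof -
    obtain i where i: "i < n + 1" "v i \<noteq> \<zero>\<^bsub>S\<^esub>" using v(2) by blast
    have "\<exists>l\<le>d. r i l \<noteq> \<zero>\<^bsub>R\<^esub>"
      using i r(2)[OF i(1)] comb_cong[of "\<lambda>l. \<zero>\<^bsub>R\<^esub>" d "r i"] comb_zero by auto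
    then show thesis using that i(1) by blast
  qed
  have "(\<Oplus>\<^bsub>R\<^esub>i\<in>{..<n + 1}. A i j \<otimes>\<^bsub>R\<^esub> r i l) = \<zero>\<^bsub>R\<^esub>" if j: "j < n" for j
  proof (rule independent[OF _ _ il(2)])
    show "(\<lambda>l. \<Oplus>\<^bsub>R\<^esub>i\<in>{..<n + 1}. A i j \<otimes>\<^bsub>R\<^esub> r i l) \<in> UNIV \<rightarrow> carrier R"
      using rc A j by (auto intro!: R.finsum_closed)
    have "comb d (\<lambda>l. \<Oplus>\<^bsub>R\<^esub>i\<in>{..<n + 1}. A i j \<otimes>\<^bsub>R\<^esub> r i l)
        = (\<Oplus>\<^bsub>S\<^esub>i\<in>{..<n + 1}. comb d (\<lambda>l. A i j \<otimes>\<^bsub>R\<^esub> r i l))"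
      using rc A j by (intro comb_finsum[symmetric]) auto
    also have "\<dots> = (\<Oplus>\<^bsub>S\<^esub>i\<in>{..<n + 1}. \<phi> (A i j) \<otimes>\<^bsub>S\<^esub> v i)"
      using r A j v(1) by (intro S.finsum_cong') (auto simp: comb_smult)
    finally show "comb d (\<lambda>l. \<Oplus>\<^bsub>R\<^esub>i\<in>{..<n + 1}. A i j \<otimes>\<^bsub>R\<^esub> r i l) = \<zero>\<^bsub>S\<^esub>"
      using v(3)[OF j] by simp
  qed
  then show "\<exists>v. (\<forall>i<n + 1. v i \<in> carrier R) \<and> (\<exists>i<n + 1. v i \<noteq> \<zero>\<^bsub>R\<^esub>) \<and>
      (\<forall>j<n. (\<Oplus>\<^bsub>R\<^esub>i\<in>{..<n + 1}. A i j \<otimes>\<^bsub>R\<^esub> v i) = \<zero>\<^bsub>R\<^esub>)"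
    using rc il by (intro exI[of _ "\<lambda>i. r i l"]) auto
qed

end


section \<open>Left and right power bases of an Ore extension\<close>

context ore
begin

section \<open>The left basis of powers of \<open>x\<close>\<close>

lemma Ore_simps [simp]:
  "carrier Ore = up R" "\<zero>\<^bsub>Ore\<^esub> = (\<lambda>n. \<zero>)" "p \<oplus>\<^bsub>Ore\<^esub> q = (\<lambda>n. p n \<oplus> q n)"
  by (simp_all add: ore_extension_def)

lemma X_pow: "ore_monom R \<one> 1 [^]\<^bsub>Ore\<^esub> (k::nat) = ore_monom R \<one> k"
proof (induction k)
  case (Suc k)
  have "ore_monom R \<one> 1 [^]\<^bsub>Ore\<^esub> Suc k = ore_monom R \<one> 1 \<otimes>\<^bsub>Ore\<^esub> ore_monom R \<one> k"
    using monoid.nat_pow_Suc2[OF ring.is_monoid[OF ore_ring], of "ore_monom R \<one> 1" k] Suc by simp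
  then show ?case by (simp add: mult_monom X_monom_one smult_monom_one)
qed (simp add: one_S)

lemma finsum_Ore:
  assumes "finite I" "\<And>i. i \<in> I \<Longrightarrow> p i \<in> up R"
  shows "(\<Oplus>\<^bsub>Ore\<^esub>i\<in>I. p i) = (\<lambda>n. \<Oplus>i\<in>I. p i n)"
proof -
  interpret Ore: ring Ore by (rule ore_ring)
  show ?thesis
    using assms
    by (induction I rule: finite_induct)
      (simp_all add: Ore.add.finprod_insert add.finprod_insert Pi_def up_closed)
qed

lemma left_twisting_element: "twisting_element R Ore (\<lambda>r. ore_monom R r 0) (ore_monom R \<one> 1)"
proof -
  interpret Ore: ring Ore by (rule ore_ring)
  show ?thesis
  proof unfold_locales
    show "\<exists>s\<in>carrier R. \<exists>t\<in>carrier R. ore_monom R \<one> 1 \<otimes>\<^bsub>Ore\<^esub> ore_monom R r 0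
        = ore_monom R s 0 \<otimes>\<^bsub>Ore\<^esub> ore_monom R \<one> 1 \<oplus>\<^bsub>Ore\<^esub> ore_monom R t 0"
      if "r \<in> carrier R" for r
      using ore_relation[OF that] that sigma_simps(1) delta_simps(1) by blast
  qed (auto simp: ore_monom_hom)
qed

text \<open>Polynomials are stored by their left coefficients, so \<open>comb d r\<close> is just
  \<open>r\<close> cut off after \<open>d\<close>; spanning and independence can be read
  off.\<close>

lemma left_power_basis: "power_basis R Ore (\<lambda>r. ore_monom R r 0) (ore_monom R \<one> 1)"
proof -
  interpret B: twisting_element R Ore "\<lambda>r. ore_monom R r 0" "ore_monom R \<one> 1"
    by (rule left_twisting_element)
  have comb: "B.comb d r n = (if n \<le> d then r n else \<zero>)" if r: "r \<in> UNIV \<rightarrow> carrier R" for d r n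
  proof -
    have rc: "r l \<in> carrier R" for l using r by auto
    have "B.comb d r = (\<Oplus>\<^bsub>Ore\<^esub>l\<in>{..d}. ore_monom R (r l) l)"
      unfolding B.comb_def using rc by (intro B.S.finsum_cong') (auto simp del: One_nat_def simp flip: ore_monom_eq)
    then have "B.comb d r n = (\<Oplus>l\<in>{..d}. if n = l then r l else \<zero>)"
      using rc by (simp add: finsum_Ore) (simp add: ore_monom_def)
    also have "\<dots> = (if n \<le> d then r n else \<zero>)"
    proof (cases "n \<le> d")
      case True
      then show ?thesis using rc by (simp add: finsum_singleton)
    next
      case False
      then have "(\<Oplus>l\<in>{..d}. if n = l then r l else \<zero>) = (\<Oplus>l\<in>{..d}. \<zero>)"
        by (intro finsum_cong') auto
      then show ?thesis using False by simp
    qed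
    finally show ?thesis .
  qed
  show ?thesis
  proof unfold_locales
    fix p assume "p \<in> carrier Ore"
    then have p: "p \<in> up R" by simp
    then obtain N where N: "\<forall>n>N. p n = \<zero>" using up_bound_ex by blast
    have pc: "p \<in> UNIV \<rightarrow> carrier R" using p up_closed by auto
    have "p = B.comb N p" using N comb[OF pc] by (auto simp: not_le)
    then show "\<exists>d. p \<in> B.span d" unfolding B.span_def using pc by blast
  next
    fix r d l assume "r \<in> UNIV \<rightarrow> carrier R" "B.comb d r = \<zero>\<^bsub>Ore\<^esub>" "l \<le> d"
    then show "r l = \<zero>" using comb[of r d l] by simp
  qed
qed

section \<open>The right basis of powers of \<open>x\<close> when \<sigma> is an
  automorphism\<close>

lemma Xi_const:
  assumes "a \<in> carrier R"
  shows "(xop ^^ l) (ore_monom R a 0) l = (\<sigma> ^^ l) a \<and>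
    (\<forall>n>l. (xop ^^ l) (ore_monom R a 0) n = \<zero>) \<and> (\<sigma> ^^ l) a \<in> carrier R"
proof (induction l)
  \<comment> \<open>Each shift applies \<sigma> to the top coefficient and moves it up by one; the
    contribution of \<delta> stays in lower degrees, which are not tracked.\<close>
  case (Suc l)
  then show ?case by (auto simp: ore_shift_def[of R \<sigma> \<delta> "(xop ^^ l) (ore_monom R a 0)"])
qed (use assms in \<open>auto simp: ore_monom_def\<close>)

lemma sigma_pow_zero:
  assumes inj: "inj_on \<sigma> (carrier R)"
  shows "a \<in> carrier R \<Longrightarrow> (\<sigma> ^^ l) a = \<zero> \<Longrightarrow> a = \<zero>"
proof (induction l arbitrary: a)
  case (Suc l)
  have "(\<sigma> ^^ l) (\<sigma> a) = \<zero>" using Suc.prems(2) by (simp add: funpow_swap1)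
  then have "\<sigma> a = \<sigma> \<zero>" using Suc.IH[of "\<sigma> a"] Suc.prems(1) by simp
  then show ?case using inj_onD[OF inj] Suc.prems(1) by blast
qed simp

text \<open>Surjectivity gives \<open>r = \<sigma> s\<close>, and
  \<open>x s = r x + \<delta> s\<close> solved for \<open>r x\<close> is the twisting relation with
  all products reversed.\<close>

lemma right_twisting_element:
  assumes "\<sigma> \<in> ring_iso R R"
  shows "twisting_element (op_ring R) (op_ring Ore) (\<lambda>r. ore_monom R r 0) (ore_monom R \<one> 1)"
proof -
  interpret Ore: ring Ore by (rule ore_ring)
  interpret P: ring "op_ring R" by (rule ring_op_ring) (rule ring_axioms)
  interpret Q: ring "op_ring Ore" by (rule ring_op_ring) (rule ore_ring)
  show ?thesis
  proof unfold_locales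
    show "(\<lambda>r. ore_monom R r 0) \<in> ring_hom (op_ring R) (op_ring Ore)"
      using ore_monom_hom by (auto simp: ring_hom_def Pi_def simp del: Ore_simps)
    fix r assume "r \<in> carrier (op_ring R)"
    then have "r \<in> \<sigma> ` carrier R"
      using assms by (auto simp: ring_iso_def bij_betw_def)
    then obtain s where s: "s \<in> carrier R" "\<sigma> s = r" by blast
    have m: "ore_monom R r 0 \<otimes>\<^bsub>Ore\<^esub> ore_monom R \<one> 1 = ore_monom R r 1"
      using s by (auto simp: mult_monom smult_monom_one X_monom_one)
    have "ore_monom R \<one> 1 \<otimes>\<^bsub>Ore\<^esub> ore_monom R s 0
        = (\<lambda>n. ore_monom R r 1 n \<oplus> ore_monom R (\<delta> s) 0 n)"
      using ore_relation[OF s(1)] unfolding s(2) m by simp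
    then have "ore_monom R r 1
        = (\<lambda>n. (ore_monom R \<one> 1 \<otimes>\<^bsub>Ore\<^esub> ore_monom R s 0) n \<oplus> ore_monom R (\<ominus> \<delta> s) 0 n)"
      using s by (intro ext) (auto simp: ore_monom_def a_assoc r_neg)
    then have "ore_monom R \<one> 1 \<otimes>\<^bsub>op_ring Ore\<^esub> ore_monom R r 0
        = ore_monom R s 0 \<otimes>\<^bsub>op_ring Ore\<^esub> ore_monom R \<one> 1 \<oplus>\<^bsub>op_ring Ore\<^esub> ore_monom R (\<ominus> \<delta> s) 0"
      by (simp add: m del: One_nat_def)
    then show "\<exists>s\<in>carrier (op_ring R). \<exists>t\<in>carrier (op_ring R).
        ore_monom R \<one> 1 \<otimes>\<^bsub>op_ring Ore\<^esub> ore_monom R r 0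
        = ore_monom R s 0 \<otimes>\<^bsub>op_ring Ore\<^esub> ore_monom R \<one> 1 \<oplus>\<^bsub>op_ring Ore\<^esub> ore_monom R t 0"
      using s by (intro bexI[of _ s] bexI[of _ "\<ominus> \<delta> s"]) auto
  qed auto
qed

text \<open>
  Independence on the right: the top coefficient of \<open>\<Sum>\<^sub>l x\<^sup>l r\<^sub>l\<close> (\<open>l \<le> d\<close>) is \<open>\<sigma>\<^sup>d(r\<^sub>d)\<close>.
\<close>

lemma right_power_basis:
  assumes "\<sigma> \<in> ring_iso R R"
  shows "power_basis (op_ring R) (op_ring Ore) (\<lambda>r. ore_monom R r 0) (ore_monom R \<one> 1)"
proof -
  interpret B: twisting_element "op_ring R" "op_ring Ore" "\<lambda>r. ore_monom R r 0" "ore_monom R \<one> 1"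
    by (rule right_twisting_element) fact
  have inj: "inj_on \<sigma> (carrier R)" using assms by (auto simp: ring_iso_def bij_betw_def)
  have pow: "ore_monom R \<one> 1 [^]\<^bsub>op_ring Ore\<^esub> k = ore_monom R \<one> k" for k :: nat
    using nat_pow_op_ring[OF ore_ring, of "ore_monom R \<one> 1" k] X_pow[of k] by simp
  \<comment> \<open>A term \<open>r x^l\<close> of the opposite ring is \<open>x^l r\<close> in the
    Ore extension, that is, the constant \<open>r\<close> shifted \<open>l\<close> times.\<close>
  have comb: "B.comb d r n = (\<Oplus>l\<in>{..d}. (xop ^^ l) (ore_monom R (r l) 0) n)"
    if r: "\<And>l. r l \<in> carrier R" for d r n
    unfolding B.comb_def using r by (simp add: pow mult_monom finsum_Ore up_closed del: One_nat_def)
  show ?thesis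
  proof unfold_locales
    fix p assume "p \<in> carrier (op_ring Ore)"
    then have "p \<in> up R" by simp
    then show "\<exists>d. p \<in> B.span d"
    proof (induction p rule: up_induct)
      case (monom a k)
      \<comment> \<open>In the opposite ring \<open>a x^k\<close> is \<open>x^k\<close> times the
        constant \<open>a\<close>; so \<open>pow_span\<close> rewrites it with coefficients on the
        other side.\<close>
      have "ore_monom R a 0 \<in> B.span 0"
        using B.span_monom[of a 0 0] monom mult_monom[of \<one> "ore_monom R a 0" 0]
        unfolding pow by (simp add: up_closed)
      from B.pow_span[OF this, of k] show ?case
        using ore_monom_eq[OF monom, of k] X_pow[of k] by (auto simp: pow simp del: One_nat_def)
    next
      case (add p q)
      then obtain d e where "p \<in> B.span d" "q \<in> B.span e" by blast
      then have "p \<in> B.span (max d e)" "q \<in> B.span (max d e)"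
        using B.span_mono[of d "max d e"] B.span_mono[of e "max d e"] by auto
      from B.span_add[OF this] show ?case by auto
    qed
  next
    fix r d l assume "r \<in> UNIV \<rightarrow> carrier (op_ring R)" "B.comb d r = \<zero>\<^bsub>op_ring Ore\<^esub>" "l \<le> d"
    then have r: "\<And>l. r l \<in> carrier R" and z: "\<And>n. (\<Oplus>l\<in>{..d}. (xop ^^ l) (ore_monom R (r l) 0) n) = \<zero>"
      and l: "l \<le> d"
      using comb[of r d] by (auto simp: Pi_def dest: fun_cong)
    show "r l = \<zero>\<^bsub>op_ring R\<^esub>"
      using z l
    proof (induction d arbitrary: l)
      case 0
      then show ?case using r 0(1)[of 0] by (simp add: ore_monom_def)
    next
      case (Suc d)
      let ?t = "\<lambda>l n. (xop ^^ l) (ore_monom R (r l) 0) n"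
      have t: "?t l n \<in> carrier R" for l n using r by (simp del: funpow.simps)
      have split: "(\<Oplus>l\<in>{..Suc d}. ?t l n) = ?t (Suc d) n \<oplus> (\<Oplus>l\<in>{..d}. ?t l n)" for n
        using t by (intro finsum_Suc) auto
      \<comment> \<open>In degree \<open>Suc d\<close> only the last summand contributes, namely
        \<open>\<sigma>^(d+1)\<close> of \<open>r (Suc d)\<close>; injectivity of \<sigma> then
        kills \<open>r (Suc d)\<close>.\<close>
      have "(\<Oplus>l\<in>{..d}. ?t l (Suc d)) = (\<Oplus>l\<in>{..d}. \<zero>)"
        using Xi_const[OF r] by (intro finsum_cong') auto
      then have "(\<sigma> ^^ Suc d) (r (Suc d)) = \<zero>"
        using split[of "Suc d"] Suc.prems(1)[of "Suc d"] Xi_const[OF r, of "Suc d" "Suc d"] t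
        by (simp del: funpow.simps)
      then have top: "r (Suc d) = \<zero>" using sigma_pow_zero[OF inj r] by blast
      \<comment> \<open>With \<open>r (Suc d)\<close> zero the last summand vanishes in every
        degree, which leaves the premise of the induction hypothesis for \<open>d\<close>.\<close>
      have "(xop ^^ k) (\<lambda>n. \<zero>) = (\<lambda>n. \<zero>)" for k
        by (induction k) (auto simp: ore_shift_def)
      moreover have "ore_monom R \<zero> 0 = (\<lambda>n. \<zero>)" by (auto simp: ore_monom_def)
      ultimately have "(\<Oplus>l\<in>{..d}. ?t l n) = \<zero>" for n
        using split[of n] Suc.prems(1)[of n] top t by (simp del: funpow.simps)
      then show ?case using Suc.IH[of l] Suc.prems(2) top by (auto simp: le_Suc_eq)
    qed
  qed
qed

end

section \<open>The four implications\<close>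

theorem theorem0p2:
  fixes R :: "('a, 'm) ring_scheme" and \<sigma> \<delta> :: "'a \<Rightarrow> 'a"
  assumes "ring R" and "\<sigma> \<in> ring_hom R R" and "skew_derivation R \<sigma> \<delta>"
  shows "(LSRC R \<longrightarrow> LSRC (ore_extension R \<sigma> \<delta>)) \<and>
         (\<sigma> \<in> ring_iso R R \<and> RSRC R \<longrightarrow> RSRC (ore_extension R \<sigma> \<delta>)) \<and>
         (RSRC (ore_extension R \<sigma> \<delta>) \<longrightarrow> RSRC R) \<and>
         (\<sigma> \<in> ring_iso R R \<and> LSRC (ore_extension R \<sigma> \<delta>) \<longrightarrow> LSRC R)"
proof -
  interpret ore R \<sigma> \<delta>
    by (rule ore.intro[OF assms(1)]) (rule ore_axioms.intro[OF assms(2,3)])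
  note left = left_power_basis and right = right_power_basis
  show ?thesis
  proof (intro conjI impI; (elim conjE)?)
    show "LSRC Ore" if "LSRC R"
      by (rule power_basis.LSRC_lift[OF left that])
    \<comment> \<open>This is the lift of LSRC between the opposite rings.\<close>
    show "RSRC Ore" if "\<sigma> \<in> ring_iso R R" "RSRC R"
      using power_basis.LSRC_lift[OF right[OF that(1)]] that(2) unfolding RSRC_eq by blast
    show "RSRC R" if "RSRC Ore"
      by (rule power_basis.RSRC_descend[OF left that])
    \<comment> \<open>RSRC of an opposite ring is LSRC of the double opposite, hence of the ring
      itself; so the descent of RSRC between the opposite rings becomes a descent of LSRC.\<close>
    show "LSRC R" if "\<sigma> \<in> ring_iso R R" "LSRC Ore"
      using power_basis.RSRC_descend[OF right[OF that(1)]] that(2)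
      unfolding RSRC_eq op_ring_op_ring by blast
  qed
qed

end
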